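(* For the two-user symmetric Gaussian interference channel with feedback model $(1111)$, every rate pair $(R_1,R_2)$ in the capacity region satisfies $$R_1+R_2\le \sup_{0\le|\rho|\le1}\left\{\log\left(1+\frac{(1-|\rho|^2)\,\mathsf{SNR}}{1+(1-|\rho|^2)\,\mathsf{INR}}\right)+\log\left(1+\mathsf{SNR}+\mathsf{INR}+2|\rho|\sqrt{\mathsf{SNR}\cdot\mathsf{INR}}\right)\right\}.$$
   Context: Symmetric Gaussian interference channel: at time $j$, transmitter $\mathsf{T}_u$ ($u\in\{1,2\}$) sends $X_{uj}\in\mathbb{C}$ and receivers $\mathsf{D}_1,\mathsf{D}_2$ receive $$Y_{1j}=g_dX_{1j}+g_cX_{2j}+Z_{1j},\qquad Y_{2j}=g_dX_{2j}+g_cX_{1j}+Z_{2j},$$ where $g_d,g_c\in\mathbb{C}$ are fixed gains and all noises $Z_{uj}\sim\mathcal{CN}(0,1)$ are independent of each other and of the messages. Power constraint: $\mathbb{E}|X_{uj}|^2\le P$. Define $\mathsf{SNR}=|g_d|^2P$, $\mathsf{INR}=|g_c|^2P$. Logarithms are base 2. Feedback model $(1111)$: there are noiseless, strictly causal feedback links from each of the two receivers to each of the two transmitters. Codes: for block length $N$, $W_u$ is uniform on $\{1,\dots,2^{NR_u}\}$, with $W_1,W_2$ independent. The encoders are $X_{uj}=f_{uj}(W_u,Y_1^{j-1},Y_2^{j-1})$, $u=1,2$, $j=1,\dots,N$, where $Y_k^{j-1}=(Y_{k1},\dots,Y_{k,j-1})$. The decoder of $\mathsf{D}_u$ is a function $\widehat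 W_u=h_u(Y_u^N)$. A rate pair is achievable if there are codes with $\Pr(\widehat W_u\neq W_u)\to0$ as $N\to\infty$ for $u=1,2$. The capacity region is the closure of the set of achievable rate pairs. *)

theory Defs
  imports "HOL-Probability.Probability"
begin

datatype user = User1 | User2

fun other :: "user \<Rightarrow> user" where
  "other User1 = User2"
| "other User2 = User1"

(* Circularly symmetric complex Gaussian law CN(0,1): total variance 1, that is,
   variance 1/2 in each of the real and imaginary parts. *)
definition std_complex_gaussian :: "complex measure" where
  "std_complex_gaussian = density lborel (\<lambda>z. ennreal (exp (- (cmod z)\<^sup>2) / pi))"

(* A block y^n is an extensional function on {1..n}: its value is undefined outside {1..n}. *)
type_synonym block = "nat \<Rightarrow> complex"

abbreviation block_space :: "nat \<Rightarrow> block measure" where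
  "block_space n \<equiv> (\<Pi>\<^sub>M i\<in>{1..n}. borel)"

(* enc C u j w y1 y2 is the symbol that transmitter u sends at time j for message w after the
   outputs y1 = Y_1^(j-1) and y2 = Y_2^(j-1) of both receivers have been fed back.
   dec C u y is the message estimate of receiver u from its own output block y = Y_u^N. *)
record code =
  enc :: "user \<Rightarrow> nat \<Rightarrow> nat \<Rightarrow> block \<Rightarrow> block \<Rightarrow> complex"
  dec :: "user \<Rightarrow> block \<Rightarrow> nat"

(* received gd gc C w z n u is Y_u^n, for the message pair w and the noise realisation z. *)
primrec received ::
  "complex \<Rightarrow> complex \<Rightarrow> code \<Rightarrow> (user \<Rightarrow> nat) \<Rightarrow> (user \<times> nat \<Rightarrow> complex) \<Rightarrow> nat \<Rightarrow> user \<Rightarrow> block"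
where
  "received gd gc C w z 0 = (\<lambda>u i. undefined)"
| "received gd gc C w z (Suc n) =
     (let Y = received gd gc C w z n;
          X = (\<lambda>u. enc C u (Suc n) (w u) (Y User1) (Y User2))
      in (\<lambda>u. (Y u)(Suc n := gd * X u + gc * X (other u) + z (u, Suc n))))"

definition channel_input ::
  "complex \<Rightarrow> complex \<Rightarrow> code \<Rightarrow> (user \<Rightarrow> nat) \<Rightarrow> (user \<times> nat \<Rightarrow> complex) \<Rightarrow> user \<Rightarrow> nat \<Rightarrow> complex"
where
  "channel_input gd gc C w z u j =
     enc C u j (w u) (received gd gc C w z (j - 1) User1) (received gd gc C w z (j - 1) User2)"

lemma received_eq:
  assumes "1 \<le> j" and "j \<le> n"
  shows "received gd gc C w z n u j =
    gd * channel_input gd gc C w z u j + gc * channel_input gd gc C w z (other u) j + z (u, j)"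
  using assms
proof (induction n)
  case (Suc n)
  then show ?case
    by (cases "j = Suc n") (auto simp: channel_input_def Let_def)
qed simp

(* Joint law of messages and noises for block length N: the W_u are uniform on {1..M u}, the
   noises Z_(u,j) are CN(0,1), and all of these are independent. *)
definition message_noise_law ::
  "(user \<Rightarrow> nat) \<Rightarrow> nat \<Rightarrow> ((user \<Rightarrow> nat) \<times> (user \<times> nat \<Rightarrow> complex)) measure"
where
  "message_noise_law M N =
     (\<Pi>\<^sub>M u\<in>UNIV. uniform_count_measure {1..M u}) \<Otimes>\<^sub>M
     (\<Pi>\<^sub>M i\<in>UNIV \<times> {1..N}. std_complex_gaussian)"

(* The power constraint uses the nonnegative integral, so that an input of infinite second
   moment violates it (a non-integrable function has Bochner integral 0). *)
definition valid_code ::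
  "complex \<Rightarrow> complex \<Rightarrow> real \<Rightarrow> (user \<Rightarrow> nat) \<Rightarrow> nat \<Rightarrow> code \<Rightarrow> bool"
where
  "valid_code gd gc P M N C \<longleftrightarrow>
     (\<forall>u. \<forall>j\<in>{1..N}. \<forall>w\<in>{1..M u}.
        (\<lambda>(y1, y2). enc C u j w y1 y2) \<in> block_space (j - 1) \<Otimes>\<^sub>M block_space (j - 1) \<rightarrow>\<^sub>M borel) \<and>
     (\<forall>u. dec C u \<in> block_space N \<rightarrow>\<^sub>M count_space UNIV) \<and>
     (\<forall>u. \<forall>j\<in>{1..N}.
        (\<integral>\<^sup>+ (w, z). ennreal ((cmod (channel_input gd gc C w z u j))\<^sup>2) \<partial>message_noise_law M N) \<le> ennreal P)"

definition error_prob ::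
  "complex \<Rightarrow> complex \<Rightarrow> (user \<Rightarrow> nat) \<Rightarrow> nat \<Rightarrow> code \<Rightarrow> user \<Rightarrow> real"
where
  "error_prob gd gc M N C u =
     measure (message_noise_law M N)
       {(w, z) \<in> space (message_noise_law M N). dec C u (received gd gc C w z N u) \<noteq> w u}"

(* 2^(NR) is rounded up to an integer. *)
definition num_messages :: "real \<Rightarrow> real \<Rightarrow> nat \<Rightarrow> user \<Rightarrow> nat" where
  "num_messages R1 R2 N u = nat \<lceil>2 powr (real N * (case u of User1 \<Rightarrow> R1 | User2 \<Rightarrow> R2))\<rceil>"

definition achievable :: "complex \<Rightarrow> complex \<Rightarrow> real \<Rightarrow> real \<Rightarrow> real \<Rightarrow> bool" where
  "achievable gd gc P R1 R2 \<longleftrightarrow> 0 \<le> R1 \<and> 0 \<le> R2 \<and>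
     (\<exists>C :: nat \<Rightarrow> code.
        (\<forall>N\<ge>1. valid_code gd gc P (num_messages R1 R2 N) N (C N)) \<and>
        (\<forall>u. (\<lambda>N. error_prob gd gc (num_messages R1 R2 N) N (C N) u) \<longlonglongrightarrow> 0))"

definition capacity_region :: "complex \<Rightarrow> complex \<Rightarrow> real \<Rightarrow> (real \<times> real) set" where
  "capacity_region gd gc P = closure {(R1, R2). achievable gd gc P R1 R2}"

definition SNR :: "complex \<Rightarrow> real \<Rightarrow> real" where
  "SNR gd P = (cmod gd)\<^sup>2 * P"

definition INR :: "complex \<Rightarrow> real \<Rightarrow> real" where
  "INR gc P = (cmod gc)\<^sup>2 * P"

end

theory Submission
  imports Defs
begin

text \<open>
  A change of measure replaces differential entropies and Fano's inequality. Let the test law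
  \<open>Q\<close> keep the messages uniform but make \<open>Y\<^sub>1\<close> an independent Gaussian sequence with variances
  \<open>A\<^sub>j\<close>, and, given \<open>W\<^sub>1\<close> and \<open>Y\<^sub>1\<close>, make \<open>Y\<^sub>2\<^sub>j\<close> Gaussian with variance \<open>v\<^sub>j\<close> around a linear
  prediction from \<open>X\<^sub>1\<^sub>j\<close> and \<open>Y\<^sub>1\<^sub>j\<close>; thanks to the feedback, \<open>X\<^sub>1\<^sub>j\<close> is a function of \<open>W\<^sub>1\<close> and past
  outputs. Under \<open>Q\<close>, \<open>Y\<^sub>1\<close> is independent of the messages and \<open>Y\<^sub>2\<close> does not depend on \<open>W\<^sub>2\<close>, so both
  decoders are right with probability at most \<open>1 / (M\<^sub>1 M\<^sub>2)\<close>. Gibbs' inequality then bounds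
  \<open>ln (M\<^sub>1 M\<^sub>2) * Pr(correct) - ln 2\<close> by the relative entropy of the true law with respect to \<open>Q\<close>, which
  is at most \<open>\<Sum> ln A\<^sub>j + ln v\<^sub>j\<close> once \<open>A\<^sub>j\<close> and \<open>v\<^sub>j\<close> dominate the second moments of \<open>Y\<^sub>1\<^sub>j\<close> and of the
  prediction error. Both can be taken as in the claim, with \<open>\<rho> = E[X\<^sub>1\<^sub>j cnj X\<^sub>2\<^sub>j] / P\<close>.
\<close>

section \<open>The standard complex Gaussian law\<close>

lemma sets_std_complex_gaussian [simp, measurable_cong]: "sets std_complex_gaussian = sets borel"
  by (simp add: std_complex_gaussian_def)

lemma space_std_complex_gaussian [simp]: "space std_complex_gaussian = UNIV"
  by (simp add: std_complex_gaussian_def)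

lemma nn_integral_std_complex_gaussian:
  assumes [measurable]: "f \<in> borel_measurable borel"
  shows "(\<integral>\<^sup>+ z. f z \<partial>std_complex_gaussian) =
    (\<integral>\<^sup>+ z. ennreal (exp (- (cmod z)\<^sup>2) / pi) * f z \<partial>lborel)"
  by (simp add: std_complex_gaussian_def nn_integral_density)

text \<open>Tonelli: \<open>lborel\<close> on the plane is the product over the basis
  \<open>{1, \<i>}\<close>, whose coordinates are \<open>Re\<close> and \<open>Im\<close>.\<close>

lemma nn_integral_lborel_complex_times:
  fixes f g :: "real \<Rightarrow> real"
  assumes [measurable]: "f \<in> borel_measurable borel" "g \<in> borel_measurable borel"
    and "\<And>x. 0 \<le> f x" "\<And>x. 0 \<le> g x"
  shows "(\<integral>\<^sup>+ z. ennreal (f (Re z) * g (Im z)) \<partial>lborel) =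
    (\<integral>\<^sup>+ x. ennreal (f x) \<partial>lborel) * (\<integral>\<^sup>+ x. ennreal (g x) \<partial>lborel)"
proof -
  let ?h = "\<lambda>b::complex. if b = 1 then (\<lambda>x. ennreal (f x)) else (\<lambda>x. ennreal (g x))"
  have "(\<integral>\<^sup>+ z. (\<Prod>b\<in>Basis. ?h b (z \<bullet> b)) \<partial>lborel) = (\<Prod>b\<in>Basis. (\<integral>\<^sup>+ x. ?h b x \<partial>lborel))"
    by (rule nn_integral_lborel_prod) auto
  then show ?thesis
    using assms(3,4) by (simp add: Basis_complex_def complex_i_not_one[symmetric] ennreal_mult)
qed

lemma std_complex_gaussian_density_eq:
  "exp (- (cmod z)\<^sup>2) / pi =
    normal_density 0 (sqrt (1/2)) (Re z) * normal_density 0 (sqrt (1/2)) (Im z)"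
proof -
  have "exp (- (cmod z)\<^sup>2) = exp (- (Re z)\<^sup>2) * exp (- (Im z)\<^sup>2)"
    by (simp add: cmod_power2 flip: exp_add)
  then show ?thesis
    by (simp add: normal_density_def)
qed

lemma nn_integral_half_normal: "(\<integral>\<^sup>+ x. ennreal (normal_density 0 (sqrt (1/2)) x) \<partial>lborel) = 1"
  by (subst nn_integral_eq_integral) auto

lemma nn_integral_half_normal_square:
  "(\<integral>\<^sup>+ x. ennreal (normal_density 0 (sqrt (1/2)) x * x\<^sup>2) \<partial>lborel) = ennreal (1/2)"
proof -
  have "has_bochner_integral lborel (\<lambda>x. normal_density 0 (sqrt (1/2)) x * x\<^sup>2) (1/2)"
    using normal_moment_even[of "sqrt (1/2)" 0 1] by (simp add: fact_numeral)
  then show ?thesis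
    by (intro nn_integral_eq_integral[THEN trans]) (simp_all only: has_bochner_integral_iff, auto)
qed

lemma emeasure_std_complex_gaussian_UNIV: "emeasure std_complex_gaussian UNIV = 1"
proof -
  have "emeasure std_complex_gaussian UNIV = (\<integral>\<^sup>+ z. 1 \<partial>std_complex_gaussian)"
    by simp
  also have "\<dots> = (\<integral>\<^sup>+ z. ennreal (normal_density 0 (sqrt (1/2)) (Re z) *
      normal_density 0 (sqrt (1/2)) (Im z)) \<partial>lborel)"
    by (subst nn_integral_std_complex_gaussian) (auto simp: std_complex_gaussian_density_eq)
  also have "\<dots> = 1"
    by (subst nn_integral_lborel_complex_times) (auto simp: nn_integral_half_normal)
  finally show ?thesis .
qed

lemma prob_space_std_complex_gaussian: "prob_space std_complex_gaussian"
  by (rule prob_spaceI) (simp add: emeasure_std_complex_gaussian_UNIV)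

lemma nn_integral_const_std_complex_gaussian [simp]: "(\<integral>\<^sup>+ z. c \<partial>std_complex_gaussian) = c"
  by (simp add: emeasure_std_complex_gaussian_UNIV)

lemma nn_integral_norm_square_std_complex_gaussian:
  "(\<integral>\<^sup>+ z. ennreal ((cmod z)\<^sup>2) \<partial>std_complex_gaussian) = 1"
proof -
  let ?n = "normal_density 0 (sqrt (1/2))"
  have "(\<integral>\<^sup>+ z. ennreal ((cmod z)\<^sup>2) \<partial>std_complex_gaussian) =
    (\<integral>\<^sup>+ z. ennreal ((?n (Re z) * (Re z)\<^sup>2) * ?n (Im z)) +
      ennreal (?n (Re z) * (?n (Im z) * (Im z)\<^sup>2)) \<partial>lborel)"
  proof (subst nn_integral_std_complex_gaussian, measurable, intro nn_integral_cong)
    fix z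
    have "exp (- (cmod z)\<^sup>2) / pi * (cmod z)\<^sup>2 =
        (?n (Re z) * (Re z)\<^sup>2) * ?n (Im z) + ?n (Re z) * (?n (Im z) * (Im z)\<^sup>2)"
      unfolding std_complex_gaussian_density_eq by (simp add: cmod_power2 algebra_simps)
    then show "ennreal (exp (- (cmod z)\<^sup>2) / pi) * ennreal ((cmod z)\<^sup>2) =
        ennreal ((?n (Re z) * (Re z)\<^sup>2) * ?n (Im z)) +
        ennreal (?n (Re z) * (?n (Im z) * (Im z)\<^sup>2))"
      by (simp flip: ennreal_plus ennreal_mult)
  qed
  also have "\<dots> = (\<integral>\<^sup>+ z. ennreal ((?n (Re z) * (Re z)\<^sup>2) * ?n (Im z)) \<partial>lborel) +
      (\<integral>\<^sup>+ z. ennreal (?n (Re z) * (?n (Im z) * (Im z)\<^sup>2)) \<partial>lborel)"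
    by (rule nn_integral_add) auto
  also have "(\<integral>\<^sup>+ z. ennreal ((?n (Re z) * (Re z)\<^sup>2) * ?n (Im z)) \<partial>lborel) = ennreal (1/2)"
    by (subst nn_integral_lborel_complex_times[of "\<lambda>x. ?n x * x\<^sup>2" ?n])
      (auto simp: nn_integral_half_normal nn_integral_half_normal_square)
  also have "(\<integral>\<^sup>+ z. ennreal (?n (Re z) * (?n (Im z) * (Im z)\<^sup>2)) \<partial>lborel) = ennreal (1/2)"
    by (subst nn_integral_lborel_complex_times[of ?n "\<lambda>x. ?n x * x\<^sup>2"])
      (auto simp: nn_integral_half_normal nn_integral_half_normal_square)
  also have "ennreal (1/2) + ennreal (1/2) = 1"
    by (subst ennreal_plus[symmetric]) simp_all
  finally show ?thesis .
qed

text \<open>The plane has real dimension 2, so scaling by \<open>c\<close> has Jacobian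
  \<open>c\<^sup>2\<close>.\<close>

lemma nn_integral_lborel_complex_affine:
  fixes f :: "complex \<Rightarrow> ennreal"
  assumes [measurable]: "f \<in> borel_measurable borel" and "c \<noteq> (0::real)"
  shows "(\<integral>\<^sup>+ z. f z \<partial>lborel) = ennreal (c\<^sup>2) * (\<integral>\<^sup>+ z. f (t + c *\<^sub>R z) \<partial>lborel)"
  by (subst lborel_affine[OF assms(2), of t])
    (simp add: nn_integral_density nn_integral_distr nn_integral_cmult)

lemma nn_integral_std_complex_gaussian_uminus:
  assumes [measurable]: "f \<in> borel_measurable borel"
  shows "(\<integral>\<^sup>+ z. f (- z) \<partial>std_complex_gaussian) = (\<integral>\<^sup>+ z. f z \<partial>std_complex_gaussian)"
  using nn_integral_lborel_complex_affine[of "\<lambda>z. ennreal (exp (- (cmod z)\<^sup>2) / pi) * f z" "-1" 0]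
  by (simp add: nn_integral_std_complex_gaussian)

text \<open>By symmetry of the noise, averaging over \<open>z\<close> and \<open>- z\<close> makes the cross term cancel
  by the parallelogram law.\<close>
lemma nn_integral_norm_square_affine_std_complex_gaussian:
  "(\<integral>\<^sup>+ z. ennreal ((cmod (a + b * z))\<^sup>2) \<partial>std_complex_gaussian) =
    ennreal ((cmod a)\<^sup>2 + (cmod b)\<^sup>2)"
proof -
  let ?I = "\<integral>\<^sup>+ z. ennreal ((cmod (a + b * z))\<^sup>2) \<partial>std_complex_gaussian"
  have par: "(cmod (a + b * z))\<^sup>2 + (cmod (a - b * z))\<^sup>2 =
      2 * (cmod a)\<^sup>2 + (2 * (cmod b)\<^sup>2) * (cmod z)\<^sup>2" for z
    unfolding cmod_power2 by simp algebra
  have "?I + ?I = ?I + (\<integral>\<^sup>+ z. ennreal ((cmod (a - b * z))\<^sup>2) \<partial>std_complex_gaussian)"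
    using nn_integral_std_complex_gaussian_uminus[of "\<lambda>z. ennreal ((cmod (a + b * z))\<^sup>2)"] by simp
  also have "\<dots> = (\<integral>\<^sup>+ z. ennreal ((cmod (a + b * z))\<^sup>2) + ennreal ((cmod (a - b * z))\<^sup>2)
      \<partial>std_complex_gaussian)"
    by (rule nn_integral_add[symmetric]) auto
  also have "\<dots> = (\<integral>\<^sup>+ z. ennreal (2 * (cmod a)\<^sup>2) + ennreal (2 * (cmod b)\<^sup>2) * ennreal ((cmod z)\<^sup>2)
      \<partial>std_complex_gaussian)"
    by (simp add: par flip: ennreal_plus ennreal_mult)
  also have "\<dots> = ennreal (2 * (cmod a)\<^sup>2) + ennreal (2 * (cmod b)\<^sup>2)"
    by (subst nn_integral_add)
      (auto simp: nn_integral_cmult nn_integral_norm_square_std_complex_gaussian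
        simp del: nn_integral_const)
  also have "\<dots> = 2 * ennreal ((cmod a)\<^sup>2 + (cmod b)\<^sup>2)"
    by (simp add: distrib_left ennreal_mult)
  finally have "2 * ?I = 2 * ennreal ((cmod a)\<^sup>2 + (cmod b)\<^sup>2)"
    by (simp add: mult_2)
  then show ?thesis
    by (auto simp: ennreal_mult_cancel_left simp del: ennreal_plus)
qed

text \<open>Change of measure for one output symbol. The exponential is the density of CN(m, A) at
  \<open>a + z\<close> divided by that of CN(0, 1) at \<open>z\<close>, so weighting by it turns the
  law of \<open>a + z\<close> into that of \<open>m + sqrt A * z\<close>.\<close>

lemma nn_integral_std_complex_gaussian_change:
  assumes [measurable]: "f \<in> borel_measurable borel" and "0 < A"
  shows "(\<integral>\<^sup>+ z. f (a + z) * ennreal (exp ((cmod z)\<^sup>2 - ln A - (cmod (a + z - m))\<^sup>2 / A))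
      \<partial>std_complex_gaussian) = (\<integral>\<^sup>+ z. f (m + sqrt A * z) \<partial>std_complex_gaussian)"
proof -
  let ?h = "\<lambda>u. f u * ennreal (exp (- (cmod (u - m))\<^sup>2 / A) / (A * pi))"
  have "(\<integral>\<^sup>+ z. f (a + z) * ennreal (exp ((cmod z)\<^sup>2 - ln A - (cmod (a + z - m))\<^sup>2 / A))
      \<partial>std_complex_gaussian) = (\<integral>\<^sup>+ z. ?h (a + z) \<partial>lborel)"
  proof (subst nn_integral_std_complex_gaussian, measurable, intro nn_integral_cong)
    fix z
    have "exp (- (cmod z)\<^sup>2) / pi * exp ((cmod z)\<^sup>2 - ln A - (cmod (a + z - m))\<^sup>2 / A) =
        exp (- (cmod (a + z - m))\<^sup>2 / A) / (A * pi)"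
      using \<open>0 < A\<close> by (simp add: exp_diff exp_minus inverse_eq_divide)
    then show "ennreal (exp (- (cmod z)\<^sup>2) / pi) *
        (f (a + z) * ennreal (exp ((cmod z)\<^sup>2 - ln A - (cmod (a + z - m))\<^sup>2 / A))) = ?h (a + z)"
      by (subst mult.left_commute) (simp flip: ennreal_mult)
  qed
  also have "\<dots> = (\<integral>\<^sup>+ u. ?h u \<partial>lborel)"
    using nn_integral_lborel_complex_affine[of ?h 1 a] by simp
  \<comment> \<open>The substitution \<open>u = m + sqrt A * z\<close> has Jacobian
    \<open>A\<close>, which cancels the \<open>A\<close> in the denominator of
    \<open>?h\<close>.\<close>
  also have "\<dots> = ennreal A * (\<integral>\<^sup>+ z. ?h (m + sqrt A * (z::complex)) \<partial>lborel)"
    using nn_integral_lborel_complex_affine[of ?h "sqrt A" m] \<open>0 < A\<close> by (simp add: scaleR_conv_of_real)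
  also have "\<dots> = (\<integral>\<^sup>+ z. ennreal A * ?h (m + sqrt A * (z::complex)) \<partial>lborel)"
    by (rule nn_integral_cmult[symmetric]) simp
  also have "\<dots> = (\<integral>\<^sup>+ z. f (m + sqrt A * z) \<partial>std_complex_gaussian)"
  proof (subst nn_integral_std_complex_gaussian, measurable, intro nn_integral_cong)
    fix z :: complex
    have "A * (exp (- (cmod (sqrt A * z))\<^sup>2 / A) / (A * pi)) = exp (- (cmod z)\<^sup>2) / pi"
      using \<open>0 < A\<close> by (simp add: norm_mult power_mult_distrib)
    then show "ennreal A * ?h (m + sqrt A * z) = ennreal (exp (- (cmod z)\<^sup>2) / pi) * f (m + sqrt A * z)"
      using \<open>0 < A\<close> by (subst mult.left_commute) (simp add: mult.commute flip: ennreal_mult)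
  qed
  finally show ?thesis .
qed

section \<open>Outputs, likelihood ratio and reference recursion for fixed messages\<close>

text \<open>Lets one noise be integrated out with the others held fixed, without changing the index
  set. Coordinate \<open>i\<close> is overwritten, so integrating its old value means integrating a
  constant against a probability measure.\<close>

lemma nn_integral_PiM_resample:
  assumes "\<And>i. prob_space (M i)" "finite I" "i \<in> I" and f [measurable]: "f \<in> borel_measurable (PiM I M)"
  shows "(\<integral>\<^sup>+ x. f x \<partial>PiM I M) = (\<integral>\<^sup>+ x. (\<integral>\<^sup>+ y. f (x(i := y)) \<partial>M i) \<partial>PiM I M)"
proof -
  interpret product_prob_space M by (rule product_prob_spaceI) (rule assms(1))
  define J where "J = I - {i}"
  have I: "I = insert i J" "insert i I = I" "finite J" "i \<notin> J"
    using assms by (auto simp: J_def)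
  have f' [measurable]: "f \<in> borel_measurable (PiM (insert i J) M)"
    using f I(1) by simp
  have add [measurable]: "(\<lambda>(x, y). x(i := y)) \<in> PiM (insert i J) M \<Otimes>\<^sub>M M i \<rightarrow>\<^sub>M PiM (insert i J) M"
    using measurable_add_dim[of i "insert i J" M] by simp
  have [measurable]: "(\<lambda>x. \<integral>\<^sup>+ y. f (x(i := y)) \<partial>M i) \<in> borel_measurable (PiM (insert i J) M)"
    using measurable_compose[OF add f'] 
    by (intro sigma_finite_measure.borel_measurable_nn_integral[OF prob_space_imp_sigma_finite[OF assms(1)]]) (simp add: case_prod_beta')
  have "(\<integral>\<^sup>+ x. (\<integral>\<^sup>+ y. f (x(i := y)) \<partial>M i) \<partial>PiM I M) =
      (\<integral>\<^sup>+ x. (\<integral>\<^sup>+ z. (\<integral>\<^sup>+ y. f (x(i := z, i := y)) \<partial>M i) \<partial>M i) \<partial>PiM J M)"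
    unfolding I(1) using I(3,4) by (intro product_nn_integral_insert) auto
  also have "\<dots> = (\<integral>\<^sup>+ x. (\<integral>\<^sup>+ y. f (x(i := y)) \<partial>M i) \<partial>PiM J M)"
    by (simp add: prob_space.emeasure_space_1[OF assms(1)])
  also have "\<dots> = (\<integral>\<^sup>+ x. f x \<partial>PiM I M)"
    unfolding I(1) using I(3,4) by (intro product_nn_integral_insert[symmetric]) auto
  finally show ?thesis ..
qed

declare One_nat_def [simp del]

lemma borel_measurable_nn_integral_fun_upd:
  assumes "\<And>i. prob_space (M i)" "i \<in> I" and f: "f \<in> borel_measurable (PiM I M)"
  shows "(\<lambda>x. \<integral>\<^sup>+ y. f (x(i := y)) \<partial>M i) \<in> borel_measurable (PiM I M)"
proof -
  have "(\<lambda>(x, y). x(i := y)) \<in> PiM I M \<Otimes>\<^sub>M M i \<rightarrow>\<^sub>M PiM I M"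
    using measurable_add_dim[of i I M] assms(2) by (simp add: insert_absorb)
  from measurable_compose[OF this f] show ?thesis
    by (intro sigma_finite_measure.borel_measurable_nn_integral[OF prob_space_imp_sigma_finite[OF assms(1)]])
      (simp add: case_prod_beta')
qed

section \<open>The noise law and causality of the channel\<close>

lemma UNIV_user: "UNIV = {User1, User2}"
  by (auto intro: user.exhaust)

instance user :: finite
  by standard (simp add: UNIV_user)

abbreviation noise_law :: "nat \<Rightarrow> (user \<times> nat \<Rightarrow> complex) measure" where
  "noise_law N \<equiv> (\<Pi>\<^sub>M i\<in>UNIV \<times> {1..N}. std_complex_gaussian)"

lemma prob_space_noise_law: "prob_space (noise_law N)"
  by (intro prob_space_PiM prob_space_std_complex_gaussian)

lemma measurable_noise_component:
  "j \<in> {1..N} \<Longrightarrow> (\<lambda>z. z (u, j)) \<in> noise_law N \<rightarrow>\<^sub>M borel"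
  using measurable_component_singleton[of "(u, j)" "UNIV \<times> {1..N}" "\<lambda>_. std_complex_gaussian"]
  by (simp cong: measurable_cong_sets)

text \<open>The noise of receiver 2 is drawn innermost: its output is predicted from the
  simultaneous output of receiver 1, which therefore has to be held fixed.\<close>

lemma nn_integral_noise_resample:
  assumes "j \<in> {1..N}" and f: "f \<in> borel_measurable (noise_law N)"
  shows "(\<integral>\<^sup>+ z. f z \<partial>noise_law N) = (\<integral>\<^sup>+ z. (\<integral>\<^sup>+ a. (\<integral>\<^sup>+ b.
    f (z((User1, j) := a, (User2, j) := b)) \<partial>std_complex_gaussian) \<partial>std_complex_gaussian) \<partial>noise_law N)"
  using assms
  by (subst nn_integral_PiM_resample[where i = "(User2, j)"],
      auto intro!: prob_space_std_complex_gaussian,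
      subst nn_integral_PiM_resample[where i = "(User1, j)"],
      auto intro!: prob_space_std_complex_gaussian
        borel_measurable_nn_integral_fun_upd[where M = "\<lambda>_. std_complex_gaussian"])

text \<open>Causality: later noises cannot reach earlier outputs. The update rules that follow keep
  the past fixed while the noise of time \<open>j\<close> is resampled.\<close>

lemma received_cong:
  "(\<And>u i. i \<in> {1..n} \<Longrightarrow> z (u, i) = z' (u, i)) \<Longrightarrow>
    received gd gc C w z n = received gd gc C w z' n"
  by (induction n) (auto simp: Let_def)

lemma received_fun_upd [simp]:
  "n < j \<Longrightarrow> received gd gc C w (z((u, j) := a)) n = received gd gc C w z n"
  by (rule received_cong) auto

lemma channel_input_fun_upd [simp]:
  "1 \<le> j \<Longrightarrow> channel_input gd gc C w (z((u, j) := a)) u' j = channel_input gd gc C w z u' j"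
  by (simp add: channel_input_def)

text \<open>\<open>llr \<dots> w z j\<close> is the logarithm of the density of the test law with respect to the true one,
  contributed by time \<open>j\<close>. The function \<open>pr\<close> predicts \<open>Y\<^sub>2\<^sub>j\<close> from the past outputs and \<open>Y\<^sub>1\<^sub>j\<close>.\<close>
definition llr ::
  "complex \<Rightarrow> complex \<Rightarrow> code \<Rightarrow> (nat \<Rightarrow> real) \<Rightarrow> (nat \<Rightarrow> real) \<Rightarrow>
    (nat \<Rightarrow> block \<Rightarrow> block \<Rightarrow> complex \<Rightarrow> complex) \<Rightarrow> (user \<Rightarrow> nat) \<Rightarrow> (user \<times> nat \<Rightarrow> complex) \<Rightarrow> nat \<Rightarrow> real"
where
  "llr gd gc C A v pr w z j =
    (let Y = received gd gc C w z (j - 1); y1 = received gd gc C w z j User1 j;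
         y2 = received gd gc C w z j User2 j
     in (cmod (z (User1, j)))\<^sup>2 - ln (A j) - (cmod y1)\<^sup>2 / A j +
        ((cmod (z (User2, j)))\<^sup>2 - ln (v j) - (cmod (y2 - pr j (Y User1) (Y User2) y1))\<^sup>2 / v j))"

lemma llr_fun_upd [simp]:
  "j < i \<Longrightarrow> llr gd gc C A v pr w (z((u, i) := a)) j = llr gd gc C A v pr w z j"
  by (simp add: llr_def Let_def)

text \<open>Realises the test law as a recursion driven by the same noise as the channel, so that the
  change of measure needs no density on the space of output blocks.\<close>
primrec reference ::
  "(nat \<Rightarrow> real) \<Rightarrow> (nat \<Rightarrow> real) \<Rightarrow> (nat \<Rightarrow> block \<Rightarrow> block \<Rightarrow> complex \<Rightarrow> complex) \<Rightarrow>
    (user \<times> nat \<Rightarrow> complex) \<Rightarrow> nat \<Rightarrow> user \<Rightarrow> block"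
where
  "reference A v pr z 0 = (\<lambda>u i. undefined)"
| "reference A v pr z (Suc n) =
    (let Y = reference A v pr z n; a = of_real (sqrt (A (Suc n))) * z (User1, Suc n);
         b = pr (Suc n) (Y User1) (Y User2) a + of_real (sqrt (v (Suc n))) * z (User2, Suc n)
     in (\<lambda>u. (Y u)(Suc n := case u of User1 \<Rightarrow> a | User2 \<Rightarrow> b)))"

lemma reference_cong:
  "(\<And>u i. i \<in> {1..n} \<Longrightarrow> z (u, i) = z' (u, i)) \<Longrightarrow> reference A v pr z n = reference A v pr z' n"
  by (induction n) (auto simp: Let_def)

lemma reference_fun_upd [simp]:
  "n < j \<Longrightarrow> reference A v pr (z((u, j) := a)) n = reference A v pr z n"
  by (rule reference_cong) auto

text \<open>The predictor enters only the second output. Hence receiver 1 can decode under the test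
  law before the message that selects the predictor is known.\<close>

lemma reference_User1_indep:
  "reference A v pr z n User1 = reference A v pr' z n User1"
  by (induction n) (auto simp: Let_def)

lemma atLeastAtMost_Suc: "{1..Suc n} = {1..n} \<union> {Suc n}"
  by auto

abbreviation valid_messages :: "(user \<Rightarrow> nat) \<Rightarrow> (user \<Rightarrow> nat) set" where
  "valid_messages M \<equiv> {w. \<forall>u. w u \<in> {1..M u}}"

section \<open>Measurability of outputs and inputs for fixed messages\<close>

locale channel_code =
  fixes gd gc :: complex and P :: real and M :: "user \<Rightarrow> nat" and N :: nat and C :: code
  assumes valid: "valid_code gd gc P M N C" and P_nonneg: "0 \<le> P" and M_pos: "\<And>u. 1 \<le> M u"
begin

abbreviation "Y \<equiv> received gd gc C"
abbreviation "X \<equiv> channel_input gd gc C"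

lemma measurable_enc:
  assumes "j \<in> {1..N}" "w \<in> valid_messages M"
  shows "(\<lambda>p. enc C u j (w u) (fst p) (snd p)) \<in> block_space (j - 1) \<Otimes>\<^sub>M block_space (j - 1) \<rightarrow>\<^sub>M borel"
  using valid assms by (simp add: valid_code_def case_prod_beta')

lemma measurable_received:
  assumes w: "w \<in> valid_messages M"
  shows "n \<le> N \<Longrightarrow> (\<lambda>z. Y w z n u) \<in> noise_law N \<rightarrow>\<^sub>M block_space n"
proof (induction n arbitrary: u)
  case 0
  \<comment> \<open>The only point of \<open>block_space 0\<close> is the everywhere undefined
    function, which is also the start value of the recursion.\<close>
  show ?case by (simp add: measurable_const space_PiM PiE_def extensional_def)
next
  case (Suc n)
  then have n: "Suc n \<in> {1..N}" and IH [measurable]: "\<And>u. (\<lambda>z. Y w z n u) \<in> noise_law N \<rightarrow>\<^sub>M block_space n"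
    by auto
  have "(\<lambda>z. (Y w z n User1, Y w z n User2)) \<in> noise_law N \<rightarrow>\<^sub>M block_space n \<Otimes>\<^sub>M block_space n"
    by measurable
  from measurable_compose[OF this measurable_enc[OF n w, simplified]]
  have [measurable]: "(\<lambda>z. enc C u (Suc n) (w u) (Y w z n User1) (Y w z n User2)) \<in> noise_law N \<rightarrow>\<^sub>M borel" for u
    by simp
  note [measurable] = measurable_noise_component[OF n]
  show ?case
    unfolding received.simps Let_def
    by (rule measurable_fun_upd[OF atLeastAtMost_Suc]) measurable
qed

lemma measurable_channel_input:
  assumes "w \<in> valid_messages M" and j: "j \<in> {1..N}"
  shows "(\<lambda>z. X w z u j) \<in> noise_law N \<rightarrow>\<^sub>M borel"
proof -
  have "(\<lambda>z. (Y w z (j - 1) User1, Y w z (j - 1) User2)) \<in> noise_law N \<rightarrow>\<^sub>M block_space (j - 1) \<Otimes>\<^sub>M block_space (j - 1)"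
    using j by (intro measurable_Pair measurable_received assms) auto
  from measurable_compose[OF this measurable_enc[OF j assms(1), of u]] show ?thesis
    by (simp add: channel_input_def)
qed

end

text \<open>The messages are fixed, so that \<open>pr\<close> may be a predictor that knows
  \<open>w User1\<close>. The variances of the test law are \<open>A\<close> and
  \<open>v\<close>.\<close>

locale channel_code_reference = channel_code +
  fixes w :: "user \<Rightarrow> nat" and A v :: "nat \<Rightarrow> real"
    and pr :: "nat \<Rightarrow> block \<Rightarrow> block \<Rightarrow> complex \<Rightarrow> complex"
  assumes w: "w \<in> valid_messages M"
    and A_pos: "\<And>j. j \<in> {1..N} \<Longrightarrow> 0 < A j" and v_pos: "\<And>j. j \<in> {1..N} \<Longrightarrow> 0 < v j"
    and measurable_pr: "\<And>j. j \<in> {1..N} \<Longrightarrow> (\<lambda>q. pr j (fst (fst q)) (snd (fst q)) (snd q)) \<in>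
      (block_space (j - 1) \<Otimes>\<^sub>M block_space (j - 1)) \<Otimes>\<^sub>M borel \<rightarrow>\<^sub>M borel"
begin

abbreviation "R \<equiv> reference A v pr"
abbreviation "L \<equiv> llr gd gc C A v pr w"

lemma measurable_pr':
  assumes j: "j \<in> {1..N}" and f: "f \<in> K \<rightarrow>\<^sub>M block_space (j - 1)" "g \<in> K \<rightarrow>\<^sub>M block_space (j - 1)"
    "h \<in> K \<rightarrow>\<^sub>M borel"
  shows "(\<lambda>x. pr j (f x) (g x) (h x)) \<in> K \<rightarrow>\<^sub>M borel"
proof -
  have "(\<lambda>x. ((f x, g x), h x)) \<in> K \<rightarrow>\<^sub>M (block_space (j - 1) \<Otimes>\<^sub>M block_space (j - 1)) \<Otimes>\<^sub>M borel"
    using f by measurable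
  from measurable_compose[OF this measurable_pr[OF j]] show ?thesis by simp
qed

lemma measurable_reference:
  "n \<le> N \<Longrightarrow> (\<lambda>z. R z n u) \<in> noise_law N \<rightarrow>\<^sub>M block_space n"
proof (induction n arbitrary: u)
  case 0
  show ?case by (simp add: measurable_const space_PiM PiE_def extensional_def)
next
  case (Suc n)
  then have n: "Suc n \<in> {1..N}" and IH [measurable]: "\<And>u. (\<lambda>z. R z n u) \<in> noise_law N \<rightarrow>\<^sub>M block_space n"
    by auto
  note [measurable] = measurable_noise_component[OF n]
  have [measurable]: "(\<lambda>z. pr (Suc n) (R z n User1) (R z n User2) (sqrt (A (Suc n)) * z (User1, Suc n)))
      \<in> noise_law N \<rightarrow>\<^sub>M borel"
    using n by (intro measurable_pr') (simp_all add: IH)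
  show ?case
    unfolding reference.simps Let_def
    by (cases u; simp only: user.case; intro measurable_fun_upd[OF atLeastAtMost_Suc]; measurable)
qed

lemma measurable_llr:
  assumes j: "j \<in> {1..N}"
  shows "(\<lambda>z. L z j) \<in> borel_measurable (noise_law N)"
proof -
  note [measurable] = measurable_noise_component[OF j]
  have [measurable]: "(\<lambda>z. Y w z j u j) \<in> noise_law N \<rightarrow>\<^sub>M borel" for u
    using measurable_compose[OF measurable_received[OF w, of j u] measurable_component_singleton[of j "{1..j}"]] j
    by auto
  have [measurable]: "(\<lambda>z. pr j (Y w z (j - 1) User1) (Y w z (j - 1) User2) (Y w z j User1 j)) \<in> noise_law N \<rightarrow>\<^sub>M borel"
    using j by (intro measurable_pr' measurable_received w) auto
  show ?thesis
    unfolding llr_def Let_def by measurable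
qed

text \<open>Induction that peels off the last time: its two noises are integrated with the past
  frozen, by the change of measure for one symbol applied twice. What remains is a function of the
  past outputs alone, hence the induction over all \<open>F\<close>.\<close>

lemma change_of_measure:
  "n \<le> N \<Longrightarrow> F \<in> borel_measurable (block_space n \<Otimes>\<^sub>M block_space n) \<Longrightarrow>
    (\<integral>\<^sup>+ z. F (Y w z n User1, Y w z n User2) * ennreal (exp (\<Sum>j\<in>{1..n}. L z j)) \<partial>noise_law N) =
    (\<integral>\<^sup>+ z. F (R z n User1, R z n User2) \<partial>noise_law N)"
proof (induction n arbitrary: F)
  case 0
  then show ?case by simp
next
  case (Suc n)
  let ?\<gamma> = std_complex_gaussian and ?B = "block_space n \<Otimes>\<^sub>M block_space n"
  let ?A = "A (Suc n)" and ?v = "v (Suc n)"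
  have n: "Suc n \<in> {1..N}" using Suc.prems by auto
  have [measurable]: "F \<in> borel_measurable (block_space (Suc n) \<Otimes>\<^sub>M block_space (Suc n))" by fact
  define e1 where "e1 p = enc C User1 (Suc n) (w User1) (fst p) (snd p)" for p
  define e2 where "e2 p = enc C User2 (Suc n) (w User2) (fst p) (snd p)" for p
  have [measurable]: "e1 \<in> ?B \<rightarrow>\<^sub>M borel" "e2 \<in> ?B \<rightarrow>\<^sub>M borel"
    using measurable_enc[OF n w] by (auto simp: e1_def[abs_def] e2_def[abs_def])
  define m1 where "m1 p = gd * e1 p + gc * e2 p" for p
  define m2 where "m2 p = gd * e2 p + gc * e1 p" for p
  have [measurable]: "m1 \<in> ?B \<rightarrow>\<^sub>M borel" "m2 \<in> ?B \<rightarrow>\<^sub>M borel"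
    by (simp_all add: m1_def[abs_def] m2_def[abs_def])
  define pred where "pred p a = pr (Suc n) (fst p) (snd p) a" for p a
  have [measurable]: "(\<lambda>q. pred (fst q) (snd q)) \<in> ?B \<Otimes>\<^sub>M borel \<rightarrow>\<^sub>M borel"
    using measurable_pr[OF n] by (simp add: pred_def)
  have pred' [measurable (raw)]: "f \<in> K \<rightarrow>\<^sub>M ?B \<Longrightarrow> g \<in> K \<rightarrow>\<^sub>M borel \<Longrightarrow> (\<lambda>x. pred (f x) (g x)) \<in> K \<rightarrow>\<^sub>M borel"
    for f g and K :: "'k measure"
    unfolding pred_def using n by (intro measurable_pr') (simp_all, measurable)
  define \<Phi> where "\<Phi> p a b = F ((fst p)(Suc n := a), (snd p)(Suc n := b))" for p a b
  have \<Phi> [measurable (raw)]: "(\<lambda>x. \<Phi> (f x) (g x) (h x)) \<in> borel_measurable K"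
    if [measurable]: "f \<in> K \<rightarrow>\<^sub>M ?B" "g \<in> K \<rightarrow>\<^sub>M borel" "h \<in> K \<rightarrow>\<^sub>M borel" for f g h and K :: "'k measure"
  proof -
    have "(\<lambda>x. (fst (f x))(Suc n := g x)) \<in> K \<rightarrow>\<^sub>M block_space (Suc n)"
      "(\<lambda>x. (snd (f x))(Suc n := h x)) \<in> K \<rightarrow>\<^sub>M block_space (Suc n)"
      by (rule measurable_fun_upd[OF atLeastAtMost_Suc]; measurable)+
    then show ?thesis
      unfolding \<Phi>_def by measurable
  qed
  \<comment> \<open>One step of the reference recursion averaged over its noise, given the past
    outputs \<open>p\<close>. The induction hypothesis is applied to this function.\<close>
  define G where "G p = (\<integral>\<^sup>+ a. (\<integral>\<^sup>+ b. \<Phi> p (sqrt ?A * a) (pred p (sqrt ?A * a) + sqrt ?v * b) \<partial>?\<gamma>) \<partial>?\<gamma>)" for p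
  interpret \<gamma>: prob_space ?\<gamma> by (rule prob_space_std_complex_gaussian)
  have G [measurable]: "G \<in> borel_measurable ?B"
    unfolding G_def[abs_def] by measurable
  let ?p = "\<lambda>z. (Y w z n User1, Y w z n User2)"
  let ?S = "\<lambda>z. ennreal (exp (\<Sum>j\<in>{1..n}. L z j))"
  let ?u = "\<lambda>z a b. z((User1, Suc n) := a, (User2, Suc n) := b)"
  have Y_meas [measurable]: "(\<lambda>z. Y w z m u) \<in> noise_law N \<rightarrow>\<^sub>M block_space m" if "m \<le> N" for m u
    using measurable_received[OF w that] .
  \<comment> \<open>Separates the weight of the past from the weights of the two new symbols. The
    term \<open>- 0\<close> displays the mean 0 of the first output under the test law.\<close>
  have step: "F (Y w (?u z a b) (Suc n) User1, Y w (?u z a b) (Suc n) User2) *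
        ennreal (exp (\<Sum>j\<in>{1..Suc n}. L (?u z a b) j)) =
      ?S z * ennreal (exp ((cmod a)\<^sup>2 - ln ?A - (cmod (m1 (?p z) + a - 0))\<^sup>2 / ?A)) *
        (\<Phi> (?p z) (m1 (?p z) + a) (m2 (?p z) + b) *
          ennreal (exp ((cmod b)\<^sup>2 - ln ?v - (cmod (m2 (?p z) + b - pred (?p z) (m1 (?p z) + a)))\<^sup>2 / ?v)))"
    for z a b
  proof -
    have L: "L (?u z a b) (Suc n) = (cmod a)\<^sup>2 - ln ?A - (cmod (m1 (?p z) + a - 0))\<^sup>2 / ?A +
        ((cmod b)\<^sup>2 - ln ?v - (cmod (m2 (?p z) + b - pred (?p z) (m1 (?p z) + a)))\<^sup>2 / ?v)"
      by (simp add: llr_def Let_def m1_def m2_def e1_def e2_def pred_def)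
    have S: "(\<Sum>j\<in>{1..Suc n}. L (?u z a b) j) = (\<Sum>j\<in>{1..n}. L z j) + L (?u z a b) (Suc n)"
      by (simp add: atLeastAtMostSuc_conv)
    have F: "F (Y w (?u z a b) (Suc n) User1, Y w (?u z a b) (Suc n) User2) =
        \<Phi> (?p z) (m1 (?p z) + a) (m2 (?p z) + b)"
      by (simp add: Let_def \<Phi>_def m1_def m2_def e1_def e2_def)
    show ?thesis
      unfolding F S L exp_add by (simp add: ennreal_mult mult_ac)
  qed
  \<comment> \<open>After the change in \<open>b\<close> the integrand depends on \<open>a\<close>
    only through \<open>m1 + a\<close> and the weight of \<open>a\<close>, so the change in
    \<open>a\<close> applies next.\<close>
  have inner: "(\<integral>\<^sup>+ a. (\<integral>\<^sup>+ b. ?S z * ennreal (exp ((cmod a)\<^sup>2 - ln ?A - (cmod (m1 (?p z) + a - 0))\<^sup>2 / ?A)) *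
        (\<Phi> (?p z) (m1 (?p z) + a) (m2 (?p z) + b) *
          ennreal (exp ((cmod b)\<^sup>2 - ln ?v - (cmod (m2 (?p z) + b - pred (?p z) (m1 (?p z) + a)))\<^sup>2 / ?v))) \<partial>?\<gamma>) \<partial>?\<gamma>)
      = G (?p z) * ?S z" if z: "z \<in> space (noise_law N)" for z
  proof -
    define p where "p = ?p z"
    have p [measurable]: "p \<in> space ?B"
      using measurable_space[OF Y_meas z] Suc.prems(1) by (auto simp: p_def space_pair_measure)
    have \<Phi>_int [measurable]: "(\<lambda>u. \<integral>\<^sup>+ b. \<Phi> p u (pred p u + sqrt ?v * b) \<partial>?\<gamma>) \<in> borel_measurable borel"
      by measurable
    have "(\<integral>\<^sup>+ a. (\<integral>\<^sup>+ b. ?S z * ennreal (exp ((cmod a)\<^sup>2 - ln ?A - (cmod (m1 p + a - 0))\<^sup>2 / ?A)) *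
        (\<Phi> p (m1 p + a) (m2 p + b) *
          ennreal (exp ((cmod b)\<^sup>2 - ln ?v - (cmod (m2 p + b - pred p (m1 p + a)))\<^sup>2 / ?v))) \<partial>?\<gamma>) \<partial>?\<gamma>) =
      (\<integral>\<^sup>+ a. ?S z * ((\<integral>\<^sup>+ b. \<Phi> p (m1 p + a) (pred p (m1 p + a) + sqrt ?v * b) \<partial>?\<gamma>) *
         ennreal (exp ((cmod a)\<^sup>2 - ln ?A - (cmod (m1 p + a - 0))\<^sup>2 / ?A))) \<partial>?\<gamma>)"
    proof (intro nn_integral_cong)
      fix a
      have "(\<integral>\<^sup>+ b. \<Phi> p (m1 p + a) (m2 p + b) *
          ennreal (exp ((cmod b)\<^sup>2 - ln ?v - (cmod (m2 p + b - pred p (m1 p + a)))\<^sup>2 / ?v)) \<partial>?\<gamma>) =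
        (\<integral>\<^sup>+ b. \<Phi> p (m1 p + a) (pred p (m1 p + a) + sqrt ?v * b) \<partial>?\<gamma>)"
        by (rule nn_integral_std_complex_gaussian_change) (auto intro!: \<Phi> simp: v_pos[OF n] p)
      then show "(\<integral>\<^sup>+ b. ?S z * ennreal (exp ((cmod a)\<^sup>2 - ln ?A - (cmod (m1 p + a - 0))\<^sup>2 / ?A)) *
        (\<Phi> p (m1 p + a) (m2 p + b) *
          ennreal (exp ((cmod b)\<^sup>2 - ln ?v - (cmod (m2 p + b - pred p (m1 p + a)))\<^sup>2 / ?v))) \<partial>?\<gamma>) =
        ?S z * ((\<integral>\<^sup>+ b. \<Phi> p (m1 p + a) (pred p (m1 p + a) + sqrt ?v * b) \<partial>?\<gamma>) *
         ennreal (exp ((cmod a)\<^sup>2 - ln ?A - (cmod (m1 p + a - 0))\<^sup>2 / ?A)))"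
        by (subst nn_integral_cmult, measurable) (simp only: mult_ac)
    qed
    also have "\<dots> = ?S z * (\<integral>\<^sup>+ a. (\<integral>\<^sup>+ b. \<Phi> p (m1 p + a) (pred p (m1 p + a) + sqrt ?v * b) \<partial>?\<gamma>) *
         ennreal (exp ((cmod a)\<^sup>2 - ln ?A - (cmod (m1 p + a - 0))\<^sup>2 / ?A)) \<partial>?\<gamma>)"
      by (rule nn_integral_cmult) measurable
    also have "(\<integral>\<^sup>+ a. (\<integral>\<^sup>+ b. \<Phi> p (m1 p + a) (pred p (m1 p + a) + sqrt ?v * b) \<partial>?\<gamma>) *
         ennreal (exp ((cmod a)\<^sup>2 - ln ?A - (cmod (m1 p + a - 0))\<^sup>2 / ?A)) \<partial>?\<gamma>) =
      (\<integral>\<^sup>+ a. (\<integral>\<^sup>+ b. \<Phi> p (0 + sqrt ?A * a) (pred p (0 + sqrt ?A * a) + sqrt ?v * b) \<partial>?\<gamma>) \<partial>?\<gamma>)"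
      by (rule nn_integral_std_complex_gaussian_change[where
            f = "\<lambda>u. \<integral>\<^sup>+ b. \<Phi> p u (pred p u + sqrt ?v * b) \<partial>?\<gamma>"]) (rule \<Phi>_int, rule A_pos[OF n])
    finally show ?thesis
      by (simp add: p_def G_def mult_ac)
  qed
  have L_meas: "(\<lambda>z. \<Sum>j\<in>{1..m}. L z j) \<in> borel_measurable (noise_law N)" if "m \<le> N" for m
    by (intro borel_measurable_sum measurable_llr) (use that in auto)
  note [measurable] = L_meas[OF Suc.prems(1)] measurable_received[OF w Suc.prems(1)]
    measurable_reference[OF Suc.prems(1)]
  have "(\<integral>\<^sup>+ z. F (Y w z (Suc n) User1, Y w z (Suc n) User2) *
        ennreal (exp (\<Sum>j\<in>{1..Suc n}. L z j)) \<partial>noise_law N) =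
      (\<integral>\<^sup>+ z. G (?p z) * ?S z \<partial>noise_law N)"
    by (subst nn_integral_noise_resample[OF n], measurable) (intro nn_integral_cong, simp only: step inner)
  also have "\<dots> = (\<integral>\<^sup>+ z. G (R z n User1, R z n User2) \<partial>noise_law N)"
    using Suc.IH[OF _ G] Suc.prems(1) by simp
  also have "\<dots> = (\<integral>\<^sup>+ z. F (R z (Suc n) User1, R z (Suc n) User2) \<partial>noise_law N)"
    by (subst nn_integral_noise_resample[OF n], measurable)
      (intro nn_integral_cong, simp add: G_def \<Phi>_def pred_def Let_def)
  finally show ?case .
qed

end

section \<open>Joint law of messages and noise\<close>

lemma all_user_iff: "(\<forall>u. Q u) \<longleftrightarrow> Q User1 \<and> Q User2"
  by (metis user.exhaust)

context channel_code
begin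

abbreviation "message_law \<equiv> \<Pi>\<^sub>M u\<in>UNIV. uniform_count_measure {1..M u}"
abbreviation "law \<equiv> message_noise_law M N"

lemma law_eq: "law = message_law \<Otimes>\<^sub>M noise_law N"
  by (simp add: message_noise_law_def)

lemma prob_space_message_law: "prob_space message_law"
  using M_pos by (intro prob_space_PiM prob_space_uniform_count_measure) auto

lemma space_message_law: "space message_law = valid_messages M"
  by (auto simp: space_PiM space_uniform_count_measure PiE_def Pi_def)

lemma sets_message_law: "sets message_law = sets (count_space (valid_messages M))"
proof -
  have "sets message_law = sets (\<Pi>\<^sub>M u\<in>UNIV. count_space {1..M u})"
    by (intro sets_PiM_cong) (auto simp: sets_uniform_count_measure)
  also have "(\<Pi>\<^sub>M u\<in>UNIV. count_space {1..M u}) = count_space (\<Pi>\<^sub>E u\<in>UNIV. {1..M u})"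
    by (intro count_space_PiM_finite) auto
  also have "(\<Pi>\<^sub>E u\<in>UNIV. {1..M u}) = valid_messages M"
    by (auto simp: PiE_def Pi_def)
  finally show ?thesis .
qed

lemma finite_valid_messages: "finite (valid_messages M)"
proof -
  have "valid_messages M = (\<Pi>\<^sub>E u\<in>UNIV. {1..M u})"
    by (auto simp: PiE_def Pi_def)
  then show ?thesis
    using finite_PiE[of "UNIV :: user set" "\<lambda>u. {1..M u}"] by simp
qed

text \<open>The messages form a finite discrete space, so each message pair can be treated
  separately.\<close>

lemma measurable_law:
  assumes "\<And>w. w \<in> valid_messages M \<Longrightarrow> (\<lambda>z. f (w, z)) \<in> noise_law N \<rightarrow>\<^sub>M K"
  shows "f \<in> law \<rightarrow>\<^sub>M K"
proof -
  have "f \<in> count_space (valid_messages M) \<Otimes>\<^sub>M noise_law N \<rightarrow>\<^sub>M K"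
    using assms finite_valid_messages by (intro measurable_pair_measure_countable1) (auto intro: countable_finite)
  then show ?thesis
    unfolding law_eq
    by (subst measurable_cong_sets[OF sets_pair_measure_cong[OF sets_message_law refl] refl])
qed

lemma prob_space_law: "prob_space law"
proof -
  interpret A: prob_space message_law by (rule prob_space_message_law)
  interpret B: prob_space "noise_law N" by (rule prob_space_noise_law)
  interpret pair_prob_space message_law "noise_law N" ..
  show ?thesis unfolding law_eq by unfold_locales
qed

lemma nn_integral_law:
  assumes "f \<in> borel_measurable law"
  shows "(\<integral>\<^sup>+ x. f x \<partial>law) = (\<integral>\<^sup>+ w. (\<integral>\<^sup>+ z. f (w, z) \<partial>noise_law N) \<partial>message_law)"
proof -
  interpret B: prob_space "noise_law N" by (rule prob_space_noise_law)
  show ?thesis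
    using assms unfolding law_eq by (simp add: B.nn_integral_fst)
qed

text \<open>The mass is exact for valid messages. Any other singleton is not measurable and has
  measure 0 by convention, so the bound serves for every \<open>w\<close>.\<close>

lemma emeasure_message_law_singleton_le:
  "emeasure message_law {w} \<le> ennreal (1 / (real (M User1) * real (M User2)))"
proof (cases "w \<in> valid_messages M")
  case True
  interpret product_prob_space "\<lambda>u. uniform_count_measure {1..M u}"
    using M_pos by (intro product_prob_spaceI prob_space_uniform_count_measure) auto
  have "{w} = (\<Pi>\<^sub>E u\<in>UNIV. {w u})"
    by (auto simp: PiE_def Pi_def)
  then have "emeasure message_law {w} = (\<Prod>u\<in>UNIV. emeasure (uniform_count_measure {1..M u}) {w u})"
    using True by (simp add: emeasure_PiM sets_uniform_count_measure)
  also have "\<dots> = (\<Prod>u\<in>UNIV. ennreal (1 / real (M u)))"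
    using True by (intro prod.cong) (auto simp: emeasure_uniform_count_measure)
  also have "\<dots> = ennreal (1 / (real (M User1) * real (M User2)))"
    by (simp add: UNIV_user flip: ennreal_mult)
  finally show ?thesis by simp
next
  case False
  then have "{w} \<notin> sets message_law"
    using sets_message_law by auto
  then show ?thesis by (simp add: emeasure_notin_sets)
qed

definition "correct = (\<lambda>(w, z). \<forall>u. dec C u (Y w z N u) = w u)"

lemma measurable_dec: "dec C u \<in> block_space N \<rightarrow>\<^sub>M count_space UNIV"
  using valid by (simp add: valid_code_def)

lemma measurable_dec_eq:
  "Measurable.pred law (\<lambda>(w, z). dec C u (Y w z N u) = w u)"
proof (rule measurable_law, simp only: prod.case)
  fix w assume w: "w \<in> valid_messages M"
  show "Measurable.pred (noise_law N) (\<lambda>z. dec C u (Y w z N u) = w u)"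
    by (rule pred_count_space_const1) (rule measurable_compose[OF measurable_received[OF w order_refl] measurable_dec])
qed

lemma measurable_correct [measurable]: "Measurable.pred law correct"
proof -
  have "Measurable.pred law (\<lambda>x. \<forall>u\<in>UNIV. (\<lambda>(w, z). dec C u (Y w z N u) = w u) x)"
    by (intro pred_intros_finite measurable_dec_eq) simp
  then show ?thesis
    by (simp add: correct_def case_prod_beta')
qed

text \<open>Union bound over the two receivers.\<close>

lemma prob_correct_ge:
  "1 - error_prob gd gc M N C User1 - error_prob gd gc M N C User2 \<le>
    measure law {x \<in> space law. correct x}"
proof -
  interpret prob_space law by (rule prob_space_law)
  let ?E = "\<lambda>u. {x \<in> space law. \<not> (\<lambda>(w, z). dec C u (Y w z N u) = w u) x}"
  have E_sets: "?E u \<in> sets law" for u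
    using measurable_dec_eq by (intro sets.sets_Collect_neg) (simp add: pred_def)
  have E: "error_prob gd gc M N C u = prob (?E u)" for u
    unfolding error_prob_def by (intro arg_cong[where f = prob]) auto
  have "{x \<in> space law. correct x} = space law - (?E User1 \<union> ?E User2)"
    by (auto simp: correct_def all_user_iff)
  then have "prob {x \<in> space law. correct x} = 1 - prob (?E User1 \<union> ?E User2)"
    using E_sets by (simp only: prob_compl sets.Un)
  moreover have "prob (?E User1 \<union> ?E User2) \<le> prob (?E User1) + prob (?E User2)"
    using E_sets by (intro measure_Un_le)
  ultimately show ?thesis
    by (simp only: E)
qed

text \<open>Under the test law the only message pair that can be decoded correctly is determined by the
  noise, hence the bound by the mass of one point.\<close>
lemma exp_moment_le:
  assumes ref: "\<And>w. w \<in> valid_messages M \<Longrightarrow>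
      channel_code_reference gd gc P M N C w A v (pr (w User1))"
  shows "(\<integral>\<^sup>+ (w, z). ennreal ((if correct (w, z) then 1 + real (M User1) * real (M User2) else 1) *
      exp (\<Sum>j\<in>{1..N}. llr gd gc C A v (pr (w User1)) w z j)) \<partial>law) \<le> 2"
proof -
  let ?M = "real (M User1) * real (M User2)"
  \<comment> \<open>Correctness as a property of the output blocks, so that it can be evaluated on
    \<open>received\<close> and on \<open>reference\<close> alike.\<close>
  define c where "c = (\<lambda>(w :: user \<Rightarrow> nat) (y1, y2). dec C User1 y1 = w User1 \<and> dec C User2 y2 = w User2)"
  define F where "F = (\<lambda>w p. ennreal (if c w p then 1 + ?M else 1))"
  let ?R = "\<lambda>w z u. reference A v (pr (w User1)) z N u"
  let ?I = "\<lambda>w z. indicator {z. c w (?R w z User1, ?R w z User2)} z :: ennreal"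
  have F_meas: "F w \<in> borel_measurable (block_space N \<Otimes>\<^sub>M block_space N)" for w
  proof -
    note [measurable] = measurable_dec
    show ?thesis unfolding F_def c_def by measurable
  qed
  have R_meas: "(\<lambda>z. ?R w z u) \<in> noise_law N \<rightarrow>\<^sub>M block_space N" if "w \<in> valid_messages M" for w u
    using channel_code_reference.measurable_reference[OF ref[OF that]] by simp
  have I_meas: "(\<lambda>(w, z). ?I w z) \<in> borel_measurable law"
  proof (rule measurable_law, simp only: prod.case)
    fix w assume w: "w \<in> valid_messages M"
    note [measurable] = measurable_dec R_meas[OF w]
    show "(\<lambda>z. ?I w z) \<in> borel_measurable (noise_law N)"
      unfolding c_def indicator_def mem_Collect_eq prod.case by measurable
  qed
  have lhs_meas: "(\<lambda>(w, z). ennreal ((if correct (w, z) then 1 + ?M else 1) *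
      exp (\<Sum>j\<in>{1..N}. llr gd gc C A v (pr (w User1)) w z j))) \<in> borel_measurable law"
  proof (rule measurable_law, simp only: prod.case)
    fix w assume w: "w \<in> valid_messages M"
    have [measurable]: "(\<lambda>z. dec C u (Y w z N u)) \<in> noise_law N \<rightarrow>\<^sub>M count_space UNIV" for u
      by (rule measurable_compose[OF measurable_received[OF w order_refl] measurable_dec])
    have [measurable]: "Measurable.pred (noise_law N) (\<lambda>z. correct (w, z))"
      unfolding correct_def prod.case by measurable
    have [measurable]: "(\<lambda>z. \<Sum>j\<in>{1..N}. llr gd gc C A v (pr (w User1)) w z j) \<in> borel_measurable (noise_law N)"
      by (intro borel_measurable_sum channel_code_reference.measurable_llr[OF ref[OF w]])
    show "(\<lambda>z. ennreal ((if correct (w, z) then 1 + ?M else 1) *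
      exp (\<Sum>j\<in>{1..N}. llr gd gc C A v (pr (w User1)) w z j))) \<in> borel_measurable (noise_law N)"
      by measurable
  qed
  have "(\<integral>\<^sup>+ (w, z). ennreal ((if correct (w, z) then 1 + ?M else 1) *
      exp (\<Sum>j\<in>{1..N}. llr gd gc C A v (pr (w User1)) w z j)) \<partial>law) =
    (\<integral>\<^sup>+ w. (\<integral>\<^sup>+ z. F w (Y w z N User1, Y w z N User2) *
      ennreal (exp (\<Sum>j\<in>{1..N}. llr gd gc C A v (pr (w User1)) w z j)) \<partial>noise_law N) \<partial>message_law)"
    by (subst nn_integral_law[OF lhs_meas], intro nn_integral_cong)
      (auto simp: F_def c_def correct_def all_user_iff ennreal_mult)
  also have "\<dots> = (\<integral>\<^sup>+ w. (\<integral>\<^sup>+ z. F w (?R w z User1, ?R w z User2) \<partial>noise_law N) \<partial>message_law)"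
    by (intro nn_integral_cong channel_code_reference.change_of_measure[OF ref] F_meas)
      (auto simp: space_message_law)
  \<comment> \<open>The constant contributes 1 and the event contributes \<open>?M\<close> times a
    probability of at most \<open>1 / ?M\<close>; together this is the bound 2.\<close>
  also have "\<dots> = (\<integral>\<^sup>+ w. (\<integral>\<^sup>+ z. 1 + ennreal ?M * ?I w z \<partial>noise_law N) \<partial>message_law)"
    by (intro nn_integral_cong) (auto simp: F_def indicator_def ennreal_plus)
  also have "\<dots> = (\<integral>\<^sup>+ x. 1 + ennreal ?M * (\<lambda>(w, z). ?I w z) x \<partial>law)"
    using I_meas by (subst nn_integral_law) auto
  also have "\<dots> = 1 + ennreal ?M * (\<integral>\<^sup>+ x. (\<lambda>(w, z). ?I w z) x \<partial>law)"
    using I_meas prob_space.emeasure_space_1[OF prob_space_law]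
    by (subst nn_integral_add) (auto simp: nn_integral_cmult)
  also have "(\<integral>\<^sup>+ x. (\<lambda>(w, z). ?I w z) x \<partial>law) \<le> ennreal (1 / ?M)"
  proof -
    interpret A: prob_space message_law by (rule prob_space_message_law)
    interpret B: prob_space "noise_law N" by (rule prob_space_noise_law)
    interpret pair_prob_space message_law "noise_law N" ..
    have "(\<integral>\<^sup>+ x. (\<lambda>(w, z). ?I w z) x \<partial>law) = (\<integral>\<^sup>+ z. (\<integral>\<^sup>+ w. ?I w z \<partial>message_law) \<partial>noise_law N)"
      using I_meas unfolding law_eq by (subst nn_integral_snd[symmetric]) auto
    also have "\<dots> \<le> (\<integral>\<^sup>+ z. ennreal (1 / ?M) \<partial>noise_law N)"
    proof (intro nn_integral_mono)
      fix z
      \<comment> \<open>The candidate pair is found successively. The first output block is the same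
        for every predictor, so \<open>pr 0\<close> serves to compute \<open>d1\<close>; the second
        block is then run with the predictor of \<open>d1\<close>.\<close>
      define d1 where "d1 = dec C User1 (reference A v (pr 0) z N User1)"
      define d2 where "d2 = dec C User2 (reference A v (pr d1) z N User2)"
      define w' where "w' = (\<lambda>u. case u of User1 \<Rightarrow> d1 | User2 \<Rightarrow> d2)"
      have "w = w'" if "c w (?R w z User1, ?R w z User2)" for w
      proof -
        have 1: "w User1 = d1"
          using that reference_User1_indep[of A v "pr (w User1)" z N "pr 0"] by (simp add: c_def d1_def)
        then have "w User2 = d2"
          using that by (simp add: c_def d2_def)
        with 1 show ?thesis
          by (auto simp: w'_def fun_eq_iff split: user.split)
      qed
      then have "(\<integral>\<^sup>+ w. ?I w z \<partial>message_law) \<le> (\<integral>\<^sup>+ w. indicator {w'} w \<partial>message_law)"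
        by (intro nn_integral_mono) (auto simp: indicator_def)
      also have "\<dots> \<le> emeasure message_law {w'}"
      proof (cases "w' \<in> valid_messages M")
        case True
        then have "{w'} \<in> sets message_law" unfolding sets_message_law by simp
        then show ?thesis by simp
      next
        \<comment> \<open>Here \<open>{w'}\<close> is not in the sigma-algebra, but its indicator
          vanishes on the whole space.\<close>
        case False
        then have "(\<integral>\<^sup>+ w. indicator {w'} w \<partial>message_law) = (\<integral>\<^sup>+ w. 0 \<partial>message_law)"
          unfolding indicator_def by (intro nn_integral_cong) (auto simp: space_message_law)
        then show ?thesis by simp
      qed
      also have "\<dots> \<le> ennreal (1 / ?M)"
        by (rule emeasure_message_law_singleton_le)
      finally show "(\<integral>\<^sup>+ w. ?I w z \<partial>message_law) \<le> ennreal (1 / ?M)" .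
    qed
    also have "\<dots> = ennreal (1 / ?M)"
      by (simp add: B.emeasure_space_1)
    finally show ?thesis .
  qed
  also have "ennreal ?M * ennreal (1 / ?M) = 1"
    using M_pos[of User1] M_pos[of User2] by (simp flip: ennreal_mult)
  finally show ?thesis
    by (simp add: add_left_mono mult_left_mono)
qed

end

section \<open>Second moments\<close>

lemma norm_square_linear:
  "(cmod (a * x + b * y))\<^sup>2 =
    (cmod a)\<^sup>2 * (cmod x)\<^sup>2 + (cmod b)\<^sup>2 * (cmod y)\<^sup>2 + 2 * Re (a * cnj b * (x * cnj y))"
  unfolding cmod_power2 by simp algebra

context channel_code
begin

lemma measurable_channel_input_law: "j \<in> {1..N} \<Longrightarrow> (\<lambda>(w, z). X w z u j) \<in> law \<rightarrow>\<^sub>M borel"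
  by (intro measurable_law) (simp add: measurable_channel_input)

lemma measurable_noise_law_component: "j \<in> {1..N} \<Longrightarrow> (\<lambda>(w, z). z (u, j)) \<in> law \<rightarrow>\<^sub>M borel"
  by (intro measurable_law) (simp add: measurable_noise_component)

text \<open>The noises of time \<open>j\<close> are independent of the inputs of time
  \<open>j\<close>, so resampling them removes all cross terms. Nonnegative integrals avoid any
  question of integrability.\<close>

lemma nn_integral_second_moment:
  assumes j: "j \<in> {1..N}"
  shows "(\<integral>\<^sup>+ (w, z). ennreal ((cmod (a * X w z User1 j + b * X w z User2 j +
        s * z (User1, j) + t * z (User2, j)))\<^sup>2) \<partial>law) =
    (\<integral>\<^sup>+ (w, z). ennreal ((cmod (a * X w z User1 j + b * X w z User2 j))\<^sup>2) \<partial>law) +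
      ennreal ((cmod s)\<^sup>2 + (cmod t)\<^sup>2)"
proof -
  let ?\<gamma> = std_complex_gaussian
  let ?m = "\<lambda>w z. a * X w z User1 j + b * X w z User2 j"
  have m_meas: "(\<lambda>z. ?m w z) \<in> noise_law N \<rightarrow>\<^sub>M borel" if "w \<in> valid_messages M" for w
    by (intro borel_measurable_add borel_measurable_times measurable_channel_input that j) auto
  have meas_w: "(\<lambda>z. ennreal ((cmod (?m w z + s * z (User1, j) + t * z (User2, j)))\<^sup>2)) \<in> borel_measurable (noise_law N)"
    "(\<lambda>z. ennreal ((cmod (?m w z))\<^sup>2)) \<in> borel_measurable (noise_law N)" if "w \<in> valid_messages M" for w
  proof -
    note [measurable] = m_meas[OF that] measurable_noise_component[OF j]
    show "(\<lambda>z. ennreal ((cmod (?m w z + s * z (User1, j) + t * z (User2, j)))\<^sup>2)) \<in> borel_measurable (noise_law N)"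
      "(\<lambda>z. ennreal ((cmod (?m w z))\<^sup>2)) \<in> borel_measurable (noise_law N)"
      by measurable
  qed
  then have meas: "(\<lambda>(w, z). ennreal ((cmod (?m w z + s * z (User1, j) + t * z (User2, j)))\<^sup>2)) \<in> borel_measurable law"
    "(\<lambda>(w, z). ennreal ((cmod (?m w z))\<^sup>2)) \<in> borel_measurable law"
    by (auto intro!: measurable_law)
  have inner: "(\<integral>\<^sup>+ z. ennreal ((cmod (?m w z + s * z (User1, j) + t * z (User2, j)))\<^sup>2) \<partial>noise_law N) =
      (\<integral>\<^sup>+ z. ennreal ((cmod (?m w z))\<^sup>2) + ennreal ((cmod s)\<^sup>2 + (cmod t)\<^sup>2) \<partial>noise_law N)"
    if w: "w \<in> valid_messages M" for w
  proof (subst nn_integral_noise_resample[OF j meas_w(1)[OF w]], intro nn_integral_cong)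
    fix z
    have "(\<integral>\<^sup>+ a. (\<integral>\<^sup>+ b. ennreal ((cmod (?m w z + s * a + t * b))\<^sup>2) \<partial>?\<gamma>) \<partial>?\<gamma>) =
        ennreal ((cmod (?m w z))\<^sup>2) + ennreal ((cmod s)\<^sup>2 + (cmod t)\<^sup>2)"
    proof -
      have "(\<integral>\<^sup>+ a. (\<integral>\<^sup>+ b. ennreal ((cmod (?m w z + s * a + t * b))\<^sup>2) \<partial>?\<gamma>) \<partial>?\<gamma>) =
          (\<integral>\<^sup>+ a. ennreal ((cmod (?m w z + s * a))\<^sup>2) + ennreal ((cmod t)\<^sup>2) \<partial>?\<gamma>)"
        by (simp only: nn_integral_norm_square_affine_std_complex_gaussian ennreal_plus zero_le_power2)
      also have "\<dots> = ennreal ((cmod (?m w z))\<^sup>2 + (cmod s)\<^sup>2) + ennreal ((cmod t)\<^sup>2)"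
        by (subst nn_integral_add)
          (simp_all only: nn_integral_norm_square_affine_std_complex_gaussian
            nn_integral_const_std_complex_gaussian, measurable)
      finally show ?thesis
        by (simp add: add.assoc)
    qed
    then show "(\<integral>\<^sup>+ a. (\<integral>\<^sup>+ b. ennreal ((cmod (?m w (z((User1, j) := a, (User2, j) := b)) +
          s * (z((User1, j) := a, (User2, j) := b)) (User1, j) +
          t * (z((User1, j) := a, (User2, j) := b)) (User2, j)))\<^sup>2) \<partial>?\<gamma>) \<partial>?\<gamma>) =
        ennreal ((cmod (?m w z))\<^sup>2) + ennreal ((cmod s)\<^sup>2 + (cmod t)\<^sup>2)"
      using j by simp
  qed
  have "(\<integral>\<^sup>+ (w, z). ennreal ((cmod (?m w z + s * z (User1, j) + t * z (User2, j)))\<^sup>2) \<partial>law) =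
      (\<integral>\<^sup>+ x. (\<lambda>(w, z). ennreal ((cmod (?m w z))\<^sup>2)) x + ennreal ((cmod s)\<^sup>2 + (cmod t)\<^sup>2) \<partial>law)"
  proof (subst nn_integral_law[OF meas(1)], subst nn_integral_law)
    show "(\<lambda>x. (\<lambda>(w, z). ennreal ((cmod (?m w z))\<^sup>2)) x + ennreal ((cmod s)\<^sup>2 + (cmod t)\<^sup>2)) \<in> borel_measurable law"
      using meas(2) by (intro borel_measurable_add) simp_all
  qed (rule nn_integral_cong, simp add: inner space_message_law del: ennreal_plus)
  also have "\<dots> = (\<integral>\<^sup>+ (w, z). ennreal ((cmod (?m w z))\<^sup>2) \<partial>law) + ennreal ((cmod s)\<^sup>2 + (cmod t)\<^sup>2)"
    using meas(2) prob_space.emeasure_space_1[OF prob_space_law]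
    by (subst nn_integral_add) (auto simp del: ennreal_plus)
  finally show ?thesis .
qed

definition "input_power u j = (\<integral>(w, z). (cmod (X w z u j))\<^sup>2 \<partial>law)"
definition "input_correlation j = (\<integral>(w, z). X w z User1 j * cnj (X w z User2 j) \<partial>law)"

lemma input_power:
  assumes j: "j \<in> {1..N}"
  shows "integrable law (\<lambda>(w, z). (cmod (X w z u j))\<^sup>2)" "0 \<le> input_power u j" "input_power u j \<le> P"
proof -
  note [measurable] = measurable_channel_input_law[OF j]
  let ?f = "\<lambda>x. (cmod ((\<lambda>(w, z). X w z u j) x))\<^sup>2"
  have le: "(\<integral>\<^sup>+ x. ennreal (?f x) \<partial>law) \<le> ennreal P"
    using valid j by (simp add: valid_code_def case_prod_beta')
  have int: "integrable law ?f"
    using le by (intro integrableI_nonneg) (auto simp: top_unique less_top[symmetric])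
  then show "integrable law (\<lambda>(w, z). (cmod (X w z u j))\<^sup>2)"
    by (simp add: case_prod_beta')
  show "0 \<le> input_power u j"
    unfolding input_power_def by (intro integral_nonneg_AE) auto
  have "ennreal (input_power u j) \<le> ennreal P"
    using le int by (subst (asm) nn_integral_eq_integral) (auto simp: input_power_def case_prod_beta')
  then show "input_power u j \<le> P"
    using P_nonneg by simp
qed

text \<open>Expands the square. The cross term is integrable because
  \<open>|x y| <= |x|^2 + |y|^2\<close>.\<close>

lemma input_second_moment:
  assumes j: "j \<in> {1..N}"
  shows "has_bochner_integral law (\<lambda>(w, z). (cmod (a * X w z User1 j + b * X w z User2 j))\<^sup>2)
    ((cmod a)\<^sup>2 * input_power User1 j + (cmod b)\<^sup>2 * input_power User2 j +
      2 * Re (a * cnj b * input_correlation j))"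
proof -
  note [measurable] = measurable_channel_input_law[OF j]
  have [measurable]: "cnj \<in> borel_measurable borel"
    by (intro borel_measurable_continuous_onI continuous_on_cnj continuous_on_id)
  let ?X = "\<lambda>u x. (\<lambda>(w, z). X w z u j) x"
  have p: "has_bochner_integral law (\<lambda>x. (cmod (?X u x))\<^sup>2) (input_power u j)" for u
    using input_power(1)[OF j, of u] by (simp add: has_bochner_integral_iff input_power_def case_prod_beta')
  have "integrable law (\<lambda>x. ?X User1 x * cnj (?X User2 x))"
  proof (rule Bochner_Integration.integrable_bound)
    show "integrable law (\<lambda>x. (cmod (?X User1 x))\<^sup>2 + (cmod (?X User2 x))\<^sup>2)"
      using p by (auto simp: has_bochner_integral_iff)
    have "cmod x * cmod y \<le> (cmod x)\<^sup>2 + (cmod y)\<^sup>2" for x y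
      using sum_squares_bound[of "cmod x" "cmod y"] mult_nonneg_nonneg[OF norm_ge_zero norm_ge_zero, of x y] by linarith
    then show "AE x in law. norm (?X User1 x * cnj (?X User2 x)) \<le> norm ((cmod (?X User1 x))\<^sup>2 + (cmod (?X User2 x))\<^sup>2)"
      by (auto simp: norm_mult)
    show "(\<lambda>x. ?X User1 x * cnj (?X User2 x)) \<in> borel_measurable law"
      by measurable
  qed
  then have c: "has_bochner_integral law (\<lambda>x. ?X User1 x * cnj (?X User2 x)) (input_correlation j)"
    by (simp add: has_bochner_integral_iff input_correlation_def case_prod_beta')
  have "has_bochner_integral law (\<lambda>x. Re (a * cnj b * (?X User1 x * cnj (?X User2 x)))) (Re (a * cnj b * input_correlation j))"
    by (rule has_bochner_integral_bounded_linear[OF bounded_linear_Re]) (rule has_bochner_integral_mult_right, rule c)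
  then have "has_bochner_integral law (\<lambda>x. (cmod a)\<^sup>2 * (cmod (?X User1 x))\<^sup>2 + (cmod b)\<^sup>2 * (cmod (?X User2 x))\<^sup>2 +
      2 * Re (a * cnj b * (?X User1 x * cnj (?X User2 x))))
    ((cmod a)\<^sup>2 * input_power User1 j + (cmod b)\<^sup>2 * input_power User2 j +
      2 * Re (a * cnj b * input_correlation j))"
    by (intro has_bochner_integral_add has_bochner_integral_mult_right p)
  then show ?thesis
    unfolding norm_square_linear by (simp add: case_prod_beta')
qed

text \<open>Positive semidefiniteness of the input covariance, in the form in which
  \<open>input_covariance\<close> assumes it.\<close>

lemma input_second_moment_nonneg:
  assumes "j \<in> {1..N}"
  shows "0 \<le> (cmod a)\<^sup>2 * input_power User1 j + (cmod b)\<^sup>2 * input_power User2 j +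
      2 * Re (a * cnj b * input_correlation j)"
proof -
  have "0 \<le> (\<integral>(w, z). (cmod (a * X w z User1 j + b * X w z User2 j))\<^sup>2 \<partial>law)"
    by (intro integral_nonneg_AE) auto
  then show ?thesis
    using input_second_moment[OF assms, of a b] by (simp add: has_bochner_integral_iff)
qed

text \<open>Every quadratic term in \<open>llr\<close> is an instance of this, once the predictor is
  linear.\<close>

lemma second_moment:
  assumes j: "j \<in> {1..N}"
  shows "has_bochner_integral law (\<lambda>(w, z). (cmod (a * X w z User1 j + b * X w z User2 j +
        s * z (User1, j) + t * z (User2, j)))\<^sup>2)
    ((cmod a)\<^sup>2 * input_power User1 j + (cmod b)\<^sup>2 * input_power User2 j +
      2 * Re (a * cnj b * input_correlation j) + ((cmod s)\<^sup>2 + (cmod t)\<^sup>2))"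
    (is "has_bochner_integral law ?f (?m + ?n)")
proof (rule has_bochner_integral_nn_integral)
  note [measurable] = measurable_channel_input_law[OF j] measurable_noise_law_component[OF j]
  have "(\<lambda>x. (cmod (a * (\<lambda>(w, z). X w z User1 j) x + b * (\<lambda>(w, z). X w z User2 j) x +
        s * (\<lambda>(w, z). z (User1, j)) x + t * (\<lambda>(w, z). z (User2, j)) x))\<^sup>2) \<in> borel_measurable law"
    by measurable
  then show "?f \<in> borel_measurable law"
    by (simp add: case_prod_beta')
  have m: "has_bochner_integral law (\<lambda>(w, z). (cmod (a * X w z User1 j + b * X w z User2 j))\<^sup>2) ?m"
    by (rule input_second_moment[OF j])
  have m_nonneg: "0 \<le> ?m"
    by (rule input_second_moment_nonneg[OF j])
  then show "0 \<le> ?m + ?n" by simp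
  have "(\<integral>\<^sup>+ (w, z). ennreal ((cmod (a * X w z User1 j + b * X w z User2 j))\<^sup>2) \<partial>law) = ennreal ?m"
    using m nn_integral_eq_integral[of law "\<lambda>(w, z). (cmod (a * X w z User1 j + b * X w z User2 j))\<^sup>2"]
    by (auto simp: has_bochner_integral_iff case_prod_beta')
  then show "(\<integral>\<^sup>+ x. ennreal (?f x) \<partial>law) = ennreal (?m + ?n)"
    using nn_integral_second_moment[OF j, of a b s t] m_nonneg
    by (simp add: case_prod_beta')
  show "AE x in law. 0 \<le> ?f x" by auto
qed

end

section \<open>Estimates for the covariance of the two inputs at one time\<close>

locale input_covariance =
  fixes P p1 p2 :: real and c :: complex
  assumes P_nonneg: "0 \<le> P" and p1_nonneg: "0 \<le> p1" and p1_le: "p1 \<le> P" and p2_le: "p2 \<le> P"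
    and second_moment_nonneg: "\<And>a b. 0 \<le> (cmod a)\<^sup>2 * p1 + (cmod b)\<^sup>2 * p2 + 2 * Re (a * cnj b * c)"
begin

text \<open>Cauchy-Schwarz from semidefiniteness: the unimodular
  \<open>a = - (cnj c / cmod c)\<close> and \<open>b = 1\<close> rotate the cross term to
  \<open>- 2 * cmod c\<close>, whence \<open>2 * cmod c <= p1 + p2\<close>.\<close>

lemma norm_correlation_le: "cmod c \<le> P"
proof (cases "c = 0")
  case False
  have "- (cnj c / cmod c) * cnj 1 * c = - complex_of_real (cmod c)"
    using False by (simp add: complex_norm_square[symmetric] mult.commute) (simp add: power2_eq_square)
  then have "Re (- (cnj c / cmod c) * cnj 1 * c) = - cmod c"
    by simp
  then show ?thesis
    using second_moment_nonneg[of "- (cnj c / cmod c)" 1] False p1_le p2_le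
    by (simp add: norm_divide)
qed (simp add: P_nonneg)

text \<open>Normalising by \<open>P\<close> instead of the actual powers keeps the estimates below valid without
  optimising; for \<open>P = 0\<close> the quotient is \<open>0\<close>.\<close>
definition "\<rho> = cmod c / P"
definition "D = (1 - \<rho>\<^sup>2) * P"

lemma rho_nonneg: "0 \<le> \<rho>"
  using P_nonneg by (simp add: \<rho>_def)

lemma rho_le_1: "\<rho> \<le> 1"
  using norm_correlation_le P_nonneg unfolding \<rho>_def by (cases "P = 0") simp_all

lemma D_nonneg: "0 \<le> D"
  using rho_nonneg rho_le_1 P_nonneg by (simp add: D_def power_le_one)

lemma D_eq: "D = P - (cmod c)\<^sup>2 / P"
  unfolding D_def \<rho>_def by (cases "P = 0") (simp_all add: power2_eq_square field_simps)

lemma output_power_le: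
  "(cmod gd)\<^sup>2 * p1 + (cmod gc)\<^sup>2 * p2 + 2 * Re (gd * cnj gc * c) + 1 \<le>
    1 + SNR gd P + INR gc P + 2 * \<rho> * sqrt (SNR gd P * INR gc P)"
proof -
  have "sqrt (SNR gd P * INR gc P) = cmod gd * cmod gc * P"
    using P_nonneg by (intro real_sqrt_unique) (auto simp: SNR_def INR_def power2_eq_square)
  \<comment> \<open>This includes \<open>P = 0\<close>, where the bound on \<open>cmod c\<close>
    forces \<open>c = 0\<close>.\<close>
  moreover have "\<rho> * P = cmod c"
    using norm_correlation_le by (auto simp: \<rho>_def)
  ultimately have "\<rho> * sqrt (SNR gd P * INR gc P) = cmod (gd * cnj gc * c)"
    by (simp add: norm_mult mult_ac)
  moreover have "Re (gd * cnj gc * c) \<le> cmod (gd * cnj gc * c)"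
    by (rule complex_Re_le_cmod)
  moreover have "(cmod gd)\<^sup>2 * p1 \<le> SNR gd P" "(cmod gc)\<^sup>2 * p2 \<le> INR gc P"
    using p1_le p2_le by (auto simp: SNR_def INR_def intro!: mult_left_mono)
  ultimately show ?thesis
    by simp
qed

text \<open>The left side is the error of estimating \<open>\<delta> * X_2\<close> by
  \<open>\<delta> * (cnj c / P) * X_1\<close>. With \<open>p1\<close> and \<open>p2\<close> raised
  to \<open>P\<close>, its terms combine to \<open>P - (cmod c)^2 / P\<close>, which is
  \<open>D\<close>.\<close>

lemma estimation_error_le:
  "(cmod (- (\<delta> * (cnj c / P))))\<^sup>2 * p1 + (cmod \<delta>)\<^sup>2 * p2 +
    2 * Re (- (\<delta> * (cnj c / P)) * cnj \<delta> * c) \<le> (cmod \<delta>)\<^sup>2 * D"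
proof -
  have "- (\<delta> * (cnj c / P)) * cnj \<delta> * c = - complex_of_real ((cmod \<delta>)\<^sup>2 * ((cmod c)\<^sup>2 / P))"
    using complex_norm_square[of c] complex_norm_square[of \<delta>] by (simp add: mult_ac)
  then have 1: "Re (- (\<delta> * (cnj c / P)) * cnj \<delta> * c) = - ((cmod \<delta>)\<^sup>2 * ((cmod c)\<^sup>2 / P))"
    by (metis Re_complex_of_real uminus_complex.simps(1))
  have "(cmod c)\<^sup>2 / P\<^sup>2 * p1 \<le> (cmod c)\<^sup>2 / P\<^sup>2 * P"
    using p1_le by (intro mult_left_mono) auto
  also have "\<dots> = (cmod c)\<^sup>2 / P"
    by (simp add: power2_eq_square)
  finally have "(cmod \<delta>)\<^sup>2 * ((cmod c)\<^sup>2 / P\<^sup>2 * p1) \<le> (cmod \<delta>)\<^sup>2 * ((cmod c)\<^sup>2 / P)"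
    by (intro mult_left_mono) auto
  moreover have "(cmod (- (\<delta> * (cnj c / P))))\<^sup>2 * p1 = (cmod \<delta>)\<^sup>2 * ((cmod c)\<^sup>2 / P\<^sup>2 * p1)"
    using P_nonneg by (simp add: norm_mult norm_divide power_mult_distrib power_divide)
  moreover have "(cmod \<delta>)\<^sup>2 * p2 \<le> (cmod \<delta>)\<^sup>2 * P"
    using p2_le by (intro mult_left_mono) auto
  ultimately show ?thesis
    unfolding 1 D_eq by (simp add: right_diff_distrib)
qed

end

text \<open>\<open>\<beta>\<close> is the Wiener coefficient for estimating \<open>gd * T + Z\<^sub>2\<close> from \<open>gc * T + Z\<^sub>1\<close> when
  \<open>T\<close> has second moment \<open>D\<close>.\<close>
lemma mmse_identity:
  fixes gd gc :: complex and D :: real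
  assumes "0 \<le> D"
  defines "\<beta> \<equiv> gd * cnj gc * D / (1 + (cmod gc)\<^sup>2 * D)"
  shows "(cmod (gd - \<beta> * gc))\<^sup>2 * D + ((cmod \<beta>)\<^sup>2 + 1) = 1 + (cmod gd)\<^sup>2 * D / (1 + (cmod gc)\<^sup>2 * D)"
proof -
  define q where "q = 1 + (cmod gc)\<^sup>2 * D"
  have q: "q > 0" using assms(1) by (simp add: q_def add_pos_nonneg)
  have \<beta>: "\<beta> = gd * cnj gc * D / q"
    by (simp add: \<beta>_def q_def)
  have "gd - \<beta> * gc = gd * (q - D * (gc * cnj gc)) / q"
    using q by (simp add: \<beta> field_simps)
  also have "\<dots> = gd / q"
    by (simp add: q_def complex_norm_square[symmetric] mult.commute)
  finally have 1: "(cmod (gd - \<beta> * gc))\<^sup>2 = (cmod gd)\<^sup>2 / q\<^sup>2"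
    using q by (simp add: norm_divide power_divide)
  have 2: "(cmod \<beta>)\<^sup>2 = (cmod gd)\<^sup>2 * (cmod gc)\<^sup>2 * D\<^sup>2 / q\<^sup>2"
    using q by (simp add: \<beta> norm_divide norm_mult power_divide power_mult_distrib)
  have "(cmod gd)\<^sup>2 / q\<^sup>2 * D + (cmod gd)\<^sup>2 * (cmod gc)\<^sup>2 * D\<^sup>2 / q\<^sup>2 = (cmod gd)\<^sup>2 * D * q / q\<^sup>2"
    by (simp add: q_def add_divide_distrib distrib_left power2_eq_square mult_ac)
  also have "\<dots> = (cmod gd)\<^sup>2 * D / q"
    using q by (simp add: power2_eq_square)
  finally show ?thesis
    unfolding 1 2 by (simp add: q_def)
qed

section \<open>The converse for a single block\<close>

context channel_code
begin

text \<open>The sum of the \<open>l j\<close> is minus the relative entropy of the true law with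
  respect to the test law. The claim is Jensen's inequality for \<open>g\<close>, whose exponential
  has expectation at most 2.\<close>

lemma relative_entropy_bound:
  assumes ref: "\<And>w. w \<in> valid_messages M \<Longrightarrow>
      channel_code_reference gd gc P M N C w A v (pr (w User1))"
    and l: "\<And>j. j \<in> {1..N} \<Longrightarrow>
      has_bochner_integral law (\<lambda>(w, z). llr gd gc C A v (pr (w User1)) w z j) (l j)"
  shows "ln (real (M User1) * real (M User2)) * measure law {x \<in> space law. correct x} +
    (\<Sum>j\<in>{1..N}. l j) \<le> ln 2"
proof -
  interpret prob_space law by (rule prob_space_law)
  let ?M = "real (M User1) * real (M User2)"
  let ?C = "{x \<in> space law. correct x}"
  define S where "S = (\<lambda>(w, z). \<Sum>j\<in>{1..N}. llr gd gc C A v (pr (w User1)) w z j)"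
  \<comment> \<open>Adds a reward \<open>ln ?M\<close> for correct decoding to the log-likelihood
    ratio; its exponential stays below the integrand of \<open>exp_moment_le\<close>.\<close>
  define g where "g x = ln ?M * indicator ?C x + S x" for x
  have M: "?M \<ge> 1"
    using M_pos[of User1] M_pos[of User2] mult_mono[of 1 "real (M User1)" 1 "real (M User2)"] by simp
  have C: "?C \<in> sets law" by measurable
  have "has_bochner_integral law (\<lambda>x. \<Sum>j\<in>{1..N}. (\<lambda>(w, z). llr gd gc C A v (pr (w User1)) w z j) x) (\<Sum>j\<in>{1..N}. l j)"
    by (intro has_bochner_integral_sum l)
  then have S: "has_bochner_integral law S (\<Sum>j\<in>{1..N}. l j)"
    by (simp add: S_def case_prod_beta')
  have "has_bochner_integral law (indicator ?C) (measure law ?C)"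
    using C by (intro has_bochner_integral_real_indicator) (auto simp: emeasure_eq_measure)
  then have g: "has_bochner_integral law g (ln ?M * measure law ?C + (\<Sum>j\<in>{1..N}. l j))"
    unfolding g_def[abs_def] by (intro has_bochner_integral_add has_bochner_integral_mult_right S)
  have [measurable]: "g \<in> borel_measurable law"
    using g by (auto simp: has_bochner_integral_iff)
  have "(\<integral>\<^sup>+ x. ennreal (exp (g x)) \<partial>law) \<le> (\<integral>\<^sup>+ (w, z). ennreal ((if correct (w, z) then 1 + ?M else 1) *
      exp (\<Sum>j\<in>{1..N}. llr gd gc C A v (pr (w User1)) w z j)) \<partial>law)"
  proof (rule nn_integral_mono)
    fix x assume "x \<in> space law"
    then have "exp (g x) = (if correct x then ?M else 1) * exp (S x)"
      using M by (simp add: g_def exp_add)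
    also have "\<dots> \<le> (if correct x then 1 + ?M else 1) * exp (S x)"
      by (intro mult_right_mono) auto
    finally show "ennreal (exp (g x)) \<le> (case x of (w, z) \<Rightarrow> ennreal ((if correct (w, z) then 1 + ?M else 1) *
      exp (\<Sum>j\<in>{1..N}. llr gd gc C A v (pr (w User1)) w z j)))"
      by (cases x) (simp add: S_def ennreal_leI)
  qed
  also have "\<dots> \<le> 2"
    by (rule exp_moment_le[OF ref])
  finally have le2: "(\<integral>\<^sup>+ x. ennreal (exp (g x)) \<partial>law) \<le> ennreal 2"
    by simp
  have int: "integrable law (\<lambda>x. exp (g x))"
    using le2 by (intro integrableI_nonneg) (auto simp: top_unique less_top[symmetric])
  have exp_le: "(\<integral>x. exp (g x) \<partial>law) \<le> 2"
    using le2 int by (subst (asm) nn_integral_eq_integral) (auto simp del: ennreal_numeral)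
  \<comment> \<open>Jensen through a tangent: \<open>ln x <= x - 1\<close> at
    \<open>x = exp (g x) / 2\<close>, which is tight where \<open>exp (g x)\<close> equals
    2.\<close>
  have "(\<integral>x. g x \<partial>law) \<le> (\<integral>x. ln 2 - 1 + exp (g x) / 2 \<partial>law)"
  proof (rule integral_mono)
    show "integrable law g" using g by (auto simp: has_bochner_integral_iff)
    show "integrable law (\<lambda>x. ln 2 - 1 + exp (g x) / 2)" using int by auto
    show "g x \<le> ln 2 - 1 + exp (g x) / 2" for x
      using ln_le_minus_one[of "exp (g x) / 2"] by (simp add: ln_div)
  qed
  also have "\<dots> = ln 2 - 1 + (\<integral>x. exp (g x) \<partial>law) / 2"
    using int by (simp add: prob_space)
  also have "\<dots> \<le> ln 2"
    using exp_le by simp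
  finally show ?thesis
    using g by (simp add: has_bochner_integral_iff)
qed

text \<open>The bound is in nats and assumed for every \<open>r\<close>, since each time has its own
  correlation; each summand is then at most \<open>B\<close> and no concavity is used.\<close>

lemma sum_rate_le:
  assumes bound: "\<And>r. 0 \<le> r \<Longrightarrow> r \<le> 1 \<Longrightarrow>
      ln (1 + (1 - r\<^sup>2) * SNR gd P / (1 + (1 - r\<^sup>2) * INR gc P)) +
      ln (1 + SNR gd P + INR gc P + 2 * r * sqrt (SNR gd P * INR gc P)) \<le> B"
  shows "ln (real (M User1) * real (M User2)) *
      (1 - error_prob gd gc M N C User1 - error_prob gd gc M N C User2) \<le> real N * B + ln 2"
proof -
  let ?c = input_correlation
  have cov: "input_covariance P (input_power User1 j) (input_power User2 j) (?c j)" if j: "j \<in> {1..N}" for j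
    using input_power[OF j] P_nonneg input_second_moment_nonneg[OF j]
    by unfold_locales auto
  \<comment> \<open>At time \<open>j\<close>, \<open>d\<close> bounds the error of estimating
    \<open>X_2\<close> by \<open>k * X_1\<close>, \<open>A\<close> is the bound of
    \<open>output_power_le\<close>, and \<open>v\<close> is the value of
    \<open>mmse_identity\<close> for \<open>D = d\<close>.\<close>
  define r where "r j = input_covariance.\<rho> P (?c j)" for j
  define d where "d j = input_covariance.D P (?c j)" for j
  define k where "k j = cnj (?c j) / P" for j
  define \<beta> where "\<beta> j = gd * cnj gc * d j / (1 + (cmod gc)\<^sup>2 * d j)" for j
  define \<delta> where "\<delta> j = gd - \<beta> j * gc" for j
  define A where "A j = 1 + SNR gd P + INR gc P + 2 * r j * sqrt (SNR gd P * INR gc P)" for j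
  define v where "v j = 1 + (cmod gd)\<^sup>2 * d j / (1 + (cmod gc)\<^sup>2 * d j)" for j
  \<comment> \<open>Equals \<open>gc * X_1 + gd * k * X_1 + \<beta> * (Y_1 - gd * X_1 - gc * k *
    X_1)\<close>: \<open>X_2\<close> is replaced by its estimate and corrected by the innovation of
    \<open>Y_1\<close>. The prediction error is
    \<open>\<delta> * (X_2 - k * X_1) + Z_2 - \<beta> * Z_1\<close>.\<close>
  define pr where "pr w j y1 y2 y = (gc + \<delta> j * k j - \<beta> j * gd) * enc C User1 j w y1 y2 + \<beta> j * y"
    for w j y1 y2 y
  have SNR: "0 \<le> SNR gd P" "0 \<le> INR gc P"
    using P_nonneg by (auto simp: SNR_def INR_def)
  have A: "1 \<le> A j" and v: "1 \<le> v j" and d: "0 \<le> d j" and r: "0 \<le> r j" "r j \<le> 1" if j: "j \<in> {1..N}" for j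
  proof -
    interpret input_covariance P "input_power User1 j" "input_power User2 j" "?c j" by (rule cov[OF j])
    show "0 \<le> d j" "0 \<le> r j" "r j \<le> 1"
      using D_nonneg rho_nonneg rho_le_1 by (simp_all add: d_def r_def)
    then show "1 \<le> A j" "1 \<le> v j"
      using SNR by (simp_all add: A_def v_def)
  qed
  have ref: "channel_code_reference gd gc P M N C w A v (pr (w User1))" if w: "w \<in> valid_messages M" for w
  proof unfold_locales
    show "w \<in> valid_messages M" by fact
    show "0 < A j" "0 < v j" if "j \<in> {1..N}" for j
      using A[OF that] v[OF that] by auto
    show "(\<lambda>q. pr (w User1) j (fst (fst q)) (snd (fst q)) (snd q)) \<in>
      (block_space (j - 1) \<Otimes>\<^sub>M block_space (j - 1)) \<Otimes>\<^sub>M borel \<rightarrow>\<^sub>M borel" if j: "j \<in> {1..N}" for j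
    proof -
      have [measurable]: "(\<lambda>q. enc C User1 j (w User1) (fst (fst q)) (snd (fst q))) \<in>
          (block_space (j - 1) \<Otimes>\<^sub>M block_space (j - 1)) \<Otimes>\<^sub>M (borel :: complex measure) \<rightarrow>\<^sub>M borel"
        by (rule measurable_compose[OF measurable_fst measurable_enc[OF j w]])
      show ?thesis
        unfolding pr_def by measurable
    qed
  qed
  \<comment> \<open>The exact expectation of \<open>llr\<close>: each 1 is the power of a noise,
    each quotient a second moment over its test variance.\<close>
  define l where "l j =
      1 - ln (A j) - ((cmod gd)\<^sup>2 * input_power User1 j + (cmod gc)\<^sup>2 * input_power User2 j +
        2 * Re (gd * cnj gc * ?c j) + 1) / A j +
      (1 - ln (v j) - ((cmod (- (\<delta> j * k j)))\<^sup>2 * input_power User1 j + (cmod (\<delta> j))\<^sup>2 * input_power User2 j +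
        2 * Re (- (\<delta> j * k j) * cnj (\<delta> j) * ?c j) + ((cmod (\<beta> j))\<^sup>2 + 1)) / v j)" for j
  have l: "has_bochner_integral law (\<lambda>(w, z). llr gd gc C A v (pr (w User1)) w z j) (l j)"
    if j: "j \<in> {1..N}" for j
  proof -
    interpret prob_space law by (rule prob_space_law)
    let ?Q = "\<lambda>a b s t x. (\<lambda>(w, z). (cmod (a * X w z User1 j + b * X w z User2 j +
        s * z (User1, j) + t * z (User2, j)))\<^sup>2) x"
    have "llr gd gc C A v (pr (w User1)) w z j =
        ?Q 0 0 1 0 (w, z) - ln (A j) - ?Q gd gc 1 0 (w, z) / A j +
        (?Q 0 0 0 1 (w, z) - ln (v j) - ?Q (- (\<delta> j * k j)) (\<delta> j) (- \<beta> j) 1 (w, z) / v j)" for w z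
    proof -
      have "Y w z j User2 j - pr (w User1) j (Y w z (j - 1) User1) (Y w z (j - 1) User2) (Y w z j User1 j) =
          - (\<delta> j * k j) * X w z User1 j + \<delta> j * X w z User2 j + (- \<beta> j) * z (User1, j) + 1 * z (User2, j)"
        using j by (simp add: received_eq pr_def \<delta>_def channel_input_def[of gd gc C w z User1] algebra_simps)
      moreover have "Y w z j User1 j = gd * X w z User1 j + gc * X w z User2 j + 1 * z (User1, j) + 0 * z (User2, j)"
        using j by (simp add: received_eq)
      ultimately show ?thesis
        unfolding llr_def Let_def by simp
    qed
    then have eq: "(\<lambda>(w, z). llr gd gc C A v (pr (w User1)) w z j) =
        (\<lambda>x. ?Q 0 0 1 0 x - ln (A j) - ?Q gd gc 1 0 x / A j +
        (?Q 0 0 0 1 x - ln (v j) - ?Q (- (\<delta> j * k j)) (\<delta> j) (- \<beta> j) 1 x / v j))"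
      by (auto simp: fun_eq_iff)
    have const: "has_bochner_integral law (\<lambda>x. r) r" for r :: real
      by (simp add: has_bochner_integral_iff prob_space)
    have Q1: "has_bochner_integral law (?Q 0 0 1 0) 1" "has_bochner_integral law (?Q 0 0 0 1) 1"
      using second_moment[OF j, of 0 0 1 0] second_moment[OF j, of 0 0 0 1] by simp_all
    have Q2: "has_bochner_integral law (?Q gd gc 1 0) ((cmod gd)\<^sup>2 * input_power User1 j +
        (cmod gc)\<^sup>2 * input_power User2 j + 2 * Re (gd * cnj gc * ?c j) + 1)"
      using second_moment[OF j, of gd gc 1 0] by simp
    have Q3: "has_bochner_integral law (?Q (- (\<delta> j * k j)) (\<delta> j) (- \<beta> j) 1)
       ((cmod (- (\<delta> j * k j)))\<^sup>2 * input_power User1 j + (cmod (\<delta> j))\<^sup>2 * input_power User2 j +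
        2 * Re (- (\<delta> j * k j) * cnj (\<delta> j) * ?c j) + ((cmod (\<beta> j))\<^sup>2 + 1))"
      using second_moment[OF j, of "- (\<delta> j * k j)" "\<delta> j" "- \<beta> j" 1] by simp
    show ?thesis
      unfolding eq l_def
      by (intro has_bochner_integral_add has_bochner_integral_diff has_bochner_integral_divide_zero const Q1 Q2 Q3)
  qed
  \<comment> \<open>Both quotients are at most 1, so they are absorbed by the noise powers, and
    \<open>- ln (A j) - ln (v j)\<close> is left.\<close>
  have l_ge: "- B \<le> l j" if j: "j \<in> {1..N}" for j
  proof -
    interpret input_covariance P "input_power User1 j" "input_power User2 j" "?c j" by (rule cov[OF j])
    have "((cmod gd)\<^sup>2 * input_power User1 j + (cmod gc)\<^sup>2 * input_power User2 j +
        2 * Re (gd * cnj gc * ?c j) + 1) / A j \<le> 1"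
      using output_power_le[of gd gc] A[OF j] by (subst divide_le_eq_1_pos) (auto simp: A_def r_def)
    moreover have "((cmod (- (\<delta> j * k j)))\<^sup>2 * input_power User1 j + (cmod (\<delta> j))\<^sup>2 * input_power User2 j +
        2 * Re (- (\<delta> j * k j) * cnj (\<delta> j) * ?c j) + ((cmod (\<beta> j))\<^sup>2 + 1)) / v j \<le> 1"
    proof -
      have "(cmod (\<delta> j))\<^sup>2 * d j + ((cmod (\<beta> j))\<^sup>2 + 1) = v j"
        using mmse_identity[OF d[OF j], of gd gc] by (simp add: \<delta>_def \<beta>_def v_def)
      then show ?thesis
        using estimation_error_le[of "\<delta> j"] v[OF j]
        by (subst divide_le_eq_1_pos) (auto simp: k_def d_def[of j, symmetric])
    qed
    moreover have "ln (v j) + ln (A j) \<le> B"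
    proof -
      have "(cmod gd)\<^sup>2 * d j = (1 - (r j)\<^sup>2) * SNR gd P" "(cmod gc)\<^sup>2 * d j = (1 - (r j)\<^sup>2) * INR gc P"
        by (simp_all add: d_def r_def input_covariance.D_def[OF cov[OF j]] SNR_def INR_def)
      then show ?thesis
        using bound[OF r[OF j]] by (simp add: v_def A_def)
    qed
    ultimately show ?thesis
      by (simp add: l_def)
  qed
  have "(\<Sum>j\<in>{1..N}. - B) \<le> (\<Sum>j\<in>{1..N}. l j)"
    by (intro sum_mono l_ge)
  then have 1: "- (real N * B) \<le> (\<Sum>j\<in>{1..N}. l j)"
    by simp
  have "0 \<le> ln (real (M User1) * real (M User2))"
    using M_pos[of User1] M_pos[of User2] by (simp add: ln_mult)
  then have "ln (real (M User1) * real (M User2)) *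
      (1 - error_prob gd gc M N C User1 - error_prob gd gc M N C User2) \<le>
      ln (real (M User1) * real (M User2)) * measure law {x \<in> space law. correct x}"
    by (intro mult_left_mono prob_correct_ge)
  with relative_entropy_bound[OF ref l] 1 show ?thesis
    by simp
qed

end

section \<open>The limit of large block length\<close>

lemma achievable_sum_rate_le:
  assumes "0 \<le> P" and ach: "achievable gd gc P R1 R2"
    and bound: "\<And>r. 0 \<le> r \<Longrightarrow> r \<le> 1 \<Longrightarrow>
      log 2 (1 + (1 - r\<^sup>2) * SNR gd P / (1 + (1 - r\<^sup>2) * INR gc P)) +
      log 2 (1 + SNR gd P + INR gc P + 2 * r * sqrt (SNR gd P * INR gc P)) \<le> B"
  shows "R1 + R2 \<le> B"
proof -
  from ach obtain C where R: "0 \<le> R1" "0 \<le> R2"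
    and valid: "\<And>N. N \<ge> 1 \<Longrightarrow> valid_code gd gc P (num_messages R1 R2 N) N (C N)"
    and err: "\<And>u. (\<lambda>N. error_prob gd gc (num_messages R1 R2 N) N (C N) u) \<longlonglongrightarrow> 0"
    by (auto simp: achievable_def)
  define e where "e N = error_prob gd gc (num_messages R1 R2 N) N (C N) User1 +
    error_prob gd gc (num_messages R1 R2 N) N (C N) User2" for N
  have e: "e \<longlonglongrightarrow> 0"
    using tendsto_add[OF err[of User1] err[of User2]] by (simp add: e_def[abs_def])
  \<comment> \<open>Rounding up only increases the number of messages.\<close>
  have M_ge: "2 powr (real N * (case u of User1 \<Rightarrow> R1 | User2 \<Rightarrow> R2)) \<le> real (num_messages R1 R2 N u)" for N u
    unfolding num_messages_def using le_of_int_ceiling by (simp add: of_nat_nat ceiling_le_iff)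
  \<comment> \<open>The two error probabilities may add up to more than 1. The sign condition allows
    the lower bound on the logarithm of the message count to be multiplied by
    \<open>1 - e N\<close>.\<close>
  have main: "(R1 + R2) * (1 - e N) \<le> B + 1 / real N" if "1 - e N \<ge> 0" "N \<ge> 1" for N
  proof -
    let ?M = "num_messages R1 R2 N"
    have pos: "0 < real (?M u)" for u
      using M_ge[of N u] by (rule less_le_trans[rotated]) simp
    interpret channel_code gd gc P ?M N "C N"
    proof
      show "1 \<le> ?M u" for u
        using pos[of u] by simp
    qed (use valid that assms in auto)
    have ln2: "ln (x :: real) = ln 2 * log 2 x" for x
      by (simp add: log_def)
    have "ln (real (?M User1) * real (?M User2)) * (1 - e N) \<le> real N * (ln 2 * B) + ln 2"
      unfolding e_def diff_diff_add[symmetric]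
    proof (rule sum_rate_le)
      fix r :: real assume "0 \<le> r" "r \<le> 1"
      then show "ln (1 + (1 - r\<^sup>2) * SNR gd P / (1 + (1 - r\<^sup>2) * INR gc P)) +
          ln (1 + SNR gd P + INR gc P + 2 * r * sqrt (SNR gd P * INR gc P)) \<le> ln 2 * B"
        unfolding ln2[of "1 + _ / _"] ln2[of "_ + 2 * r * _"] distrib_left[symmetric]
        by (intro mult_left_mono bound) auto
    qed
    moreover have "ln 2 * (real N * (R1 + R2)) \<le> ln (real (?M User1) * real (?M User2))"
    proof -
      have "ln 2 * (real N * (R1 + R2)) = ln (2 powr (real N * R1) * 2 powr (real N * R2))"
        by (simp add: ln_powr flip: powr_add) (simp add: algebra_simps)
      also have "\<dots> \<le> ln (real (?M User1) * real (?M User2))"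
        using M_ge[of N User1] M_ge[of N User2] by (intro ln_mono mult_mono) auto
      finally show ?thesis .
    qed
    ultimately have "ln 2 * (real N * (R1 + R2)) * (1 - e N) \<le> real N * (ln 2 * B) + ln 2"
      using that(1) by (meson mult_right_mono order_trans)
    then have "ln 2 * real N * ((R1 + R2) * (1 - e N)) \<le> ln 2 * real N * (B + 1 / real N)"
      using that(2) by (simp add: algebra_simps)
    then show ?thesis
      using that(2) by (simp add: mult_le_cancel_left_pos)
  qed
  have "eventually (\<lambda>N. e N < 1) sequentially"
    using e by (rule order_tendstoD) simp
  then have ev: "eventually (\<lambda>N. (R1 + R2) * (1 - e N) \<le> B + 1 / real N) sequentially"
    using eventually_ge_at_top[of 1] by eventually_elim (intro main, auto)
  have lhs: "(\<lambda>N. (R1 + R2) * (1 - e N)) \<longlonglongrightarrow> (R1 + R2) * (1 - 0)"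
    by (intro tendsto_intros e)
  have rhs: "(\<lambda>N. B + 1 / real N) \<longlonglongrightarrow> B + 0"
    by (intro tendsto_intros lim_1_over_n)
  show ?thesis
    using tendsto_le[OF _ rhs lhs ev] by simp
qed

theorem theoremV2:
  fixes gd gc :: complex and P R1 R2 :: real
  assumes "0 \<le> P"
    and "(R1, R2) \<in> capacity_region gd gc P"
  shows "R1 + R2 \<le>
    (SUP \<rho> \<in> {\<rho> :: complex. 0 \<le> cmod \<rho> \<and> cmod \<rho> \<le> 1}.
        log 2 (1 + (1 - (cmod \<rho>)\<^sup>2) * SNR gd P / (1 + (1 - (cmod \<rho>)\<^sup>2) * INR gc P)) +
        log 2 (1 + SNR gd P + INR gc P + 2 * cmod \<rho> * sqrt (SNR gd P * INR gc P)))"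
    (is "_ \<le> (SUP \<rho> \<in> ?S. ?F \<rho>)")
proof -
  have SNR: "0 \<le> SNR gd P" "0 \<le> INR gc P"
    using assms(1) by (auto simp: SNR_def INR_def)
  \<comment> \<open>A real supremum is an upper bound only for a set that is bounded above.\<close>
  have bdd: "bdd_above (?F ` ?S)"
  proof (rule bdd_aboveI2)
    fix \<rho> :: complex assume \<rho>: "\<rho> \<in> ?S"
    then have r: "0 \<le> 1 - (cmod \<rho>)\<^sup>2" "1 - (cmod \<rho>)\<^sup>2 \<le> 1"
      by (auto simp: power_le_one)
    have "(1 - (cmod \<rho>)\<^sup>2) * SNR gd P / (1 + (1 - (cmod \<rho>)\<^sup>2) * INR gc P) \<le> SNR gd P / 1"
      using r SNR by (intro frac_le) (auto intro: mult_left_le_one_le)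
    moreover have "0 \<le> (1 - (cmod \<rho>)\<^sup>2) * SNR gd P / (1 + (1 - (cmod \<rho>)\<^sup>2) * INR gc P)"
      using r SNR by auto
    moreover have "2 * cmod \<rho> * sqrt (SNR gd P * INR gc P) \<le> 2 * 1 * sqrt (SNR gd P * INR gc P)"
      using \<rho> SNR by (intro mult_right_mono mult_left_mono) auto
    moreover have "0 \<le> 2 * cmod \<rho> * sqrt (SNR gd P * INR gc P)"
      using SNR by auto
    ultimately show "?F \<rho> \<le> log 2 (1 + SNR gd P) +
        log 2 (1 + SNR gd P + INR gc P + 2 * 1 * sqrt (SNR gd P * INR gc P))"
      using SNR by (intro add_mono) (auto intro!: log_mono add_pos_nonneg)
  qed
  \<comment> \<open>The half-plane on the right is closed, so the bound passes to the
    closure.\<close>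
  have "{(R1, R2). achievable gd gc P R1 R2} \<subseteq> {p. fst p + snd p \<le> (SUP \<rho> \<in> ?S. ?F \<rho>)}"
  proof clarify
    fix R1 R2 assume "achievable gd gc P R1 R2"
    then have "R1 + R2 \<le> (SUP \<rho> \<in> ?S. ?F \<rho>)"
    proof (rule achievable_sum_rate_le[OF assms(1)])
      fix r :: real assume "0 \<le> r" "r \<le> 1"
      \<comment> \<open>The objective depends only on the modulus, so the real \<open>r\<close> is
        attained by the complex number \<open>of_real r\<close>.\<close>
      then show "log 2 (1 + (1 - r\<^sup>2) * SNR gd P / (1 + (1 - r\<^sup>2) * INR gc P)) +
          log 2 (1 + SNR gd P + INR gc P + 2 * r * sqrt (SNR gd P * INR gc P)) \<le> (SUP \<rho> \<in> ?S. ?F \<rho>)"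
        using cSUP_upper[OF _ bdd, of "of_real r"] by simp
    qed
    then show "fst (R1, R2) + snd (R1, R2) \<le> (SUP \<rho> \<in> ?S. ?F \<rho>)" by simp
  qed
  then have "capacity_region gd gc P \<subseteq> {p. fst p + snd p \<le> (SUP \<rho> \<in> ?S. ?F \<rho>)}"
    unfolding capacity_region_def
    by (rule closure_minimal) (intro closed_Collect_le continuous_intros)
  then show ?thesis
    using assms(2) by auto
qed

end
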